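(* Let $n\ge1$, $\alpha\in(0,n)$ and $r>0$. For every $m>0$ there exists a minimizer $E_m$ of the problem $$\min\left\{\mathrm{Per}_{r m^{1/n}}(E)+\Phi_\alpha(E)\;:\; E\subseteq\mathbb{R}^n \text{ convex},\ |E|=m\right\}.$$ Moreover, let $E_m$ be a minimizer for each $m>0$ and set $\tilde E_m:=m^{-1/n}E_m$. Then, up to translations (that is, after replacing each $\tilde E_m$ by a suitable translate of it), as $m\to0$, $$|\tilde E_m\,\Delta\, B|\to 0\qquad\text{and}\qquad d_H(\tilde E_m,B)\to0,$$ where $B$ is the ball centered at the origin with $|B|=1$ and $d_H$ denotes the Hausdorff distance.
   Context: $|\cdot|$ denotes $n$-dimensional Lebesgue measure, $B_\rho(x)$ is the open ball of radius $\rho$ centered at $x$, and $E\Delta F$ is the symmetric difference. Every measurable set $E\subseteq\mathbb{R}^n$ is identified with the set of its points of Lebesgue density one, and $\partial E$ denotes its measure-theoretic (essential) boundary, i.e. the set of points at which $E$ has neither density $0$ nor density $1$. For $\rho>0$ and $A\subseteq\mathbb{R}^n$, $A\oplus B_\rho:=\bigcup_{x\in A}B_\rho(x)$. The nonlocal perimeter of Minkowski type at scale $\rho>0$ is $$\mathrm{Per}_\rho(E):=\frac{1}{2\rho}\,\big|(\partial E)\oplus B_\rho\big| .$$ The Riesz energy is $$\Phi_\alpha(E):=\int_E\int_E\frac{1}{|x-y|^\alpha}\,dx\,dy,\qquad \alpha\in(0,n).$$ *)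

theory Defs
  imports "HOL-Analysis.Analysis"
begin

definition has_density :: "'a::euclidean_space set \<Rightarrow> 'a \<Rightarrow> real \<Rightarrow> bool" where
  "has_density E x d \<longleftrightarrow>
     ((\<lambda>\<rho>. measure lebesgue (E \<inter> ball x \<rho>) / measure lebesgue (ball x \<rho>)) \<longlongrightarrow> d) (at_right 0)"

definition density_one :: "'a::euclidean_space set \<Rightarrow> 'a set" where
  "density_one E = {x. has_density E x 1}"

definition ess_boundary :: "'a::euclidean_space set \<Rightarrow> 'a set" where
  "ess_boundary E = {x. \<not> has_density E x 0 \<and> \<not> has_density E x 1}"

definition Per :: "real \<Rightarrow> 'a::euclidean_space set \<Rightarrow> ennreal" where
  "Per \<rho> E = ennreal (1 / (2 * \<rho>)) * emeasure lebesgue (\<Union>x\<in>ess_boundary E. ball x \<rho>)"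

text \<open>On the diagonal the kernel takes the value \<open>1 / 0 = 0\<close> instead of \<open>\<infinity>\<close>; this does not
  affect the integral, since singletons are null sets.\<close>

definition riesz_energy :: "real \<Rightarrow> 'a::euclidean_space set \<Rightarrow> ennreal" where
  "riesz_energy \<alpha> E =
     (\<integral>\<^sup>+x\<in>E. (\<integral>\<^sup>+y\<in>E. ennreal (1 / norm (x - y) powr \<alpha>) \<partial>lebesgue) \<partial>lebesgue)"

text \<open>Measurable sets that agree up to a null set are identified, the representative being the set
  of points of density one. The condition \<open>density_one E = E\<close> says that \<open>E\<close> is
  this representative; convexity and the Hausdorff distance refer to it.\<close>

definition admissible :: "real \<Rightarrow> 'a::euclidean_space set set" where
  "admissible m = {E. E \<in> sets lebesgue \<and> density_one E = E \<and> convex E \<and>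
                      emeasure lebesgue E = ennreal m}"

definition energy :: "real \<Rightarrow> real \<Rightarrow> real \<Rightarrow> 'a::euclidean_space set \<Rightarrow> ennreal" where
  "energy \<alpha> r m E = Per (r * m powr (1 / real DIM('a))) E + riesz_energy \<alpha> E"

definition is_minimizer :: "real \<Rightarrow> real \<Rightarrow> real \<Rightarrow> 'a::euclidean_space set \<Rightarrow> bool" where
  "is_minimizer \<alpha> r m E \<longleftrightarrow>
     E \<in> admissible m \<and> (\<forall>F\<in>(admissible m :: 'a set set). energy \<alpha> r m E \<le> energy \<alpha> r m F)"

definition rescaled :: "real \<Rightarrow> 'a::euclidean_space set \<Rightarrow> 'a set" where
  "rescaled m E = (\<lambda>x. (m powr (- 1 / real DIM('a))) *\<^sub>R x) ` E"

definition hausdorff_dist :: "'a::metric_space set \<Rightarrow> 'a set \<Rightarrow> ennreal" where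
  "hausdorff_dist A B =
     max (SUP x\<in>A. INF y\<in>B. ennreal (dist x y)) (SUP y\<in>B. INF x\<in>A. ennreal (dist x y))"

end

theory Submission imports Defs "HOL-Complex_Analysis.Great_Picard"
begin

text \<open>
After rescaling to unit volume the Riesz term carries a factor that tends to \<open>0\<close> with \<open>m\<close>. So the
statement rests on three facts: the ball minimizes the nonlocal perimeter at the fixed scale \<open>r\<close> among
convex sets of unit volume, it is the only minimizer up to translations, and convex sets of unit
volume with bounded perimeter form a compact family up to translations.

For a convex open set the essential boundary is the topological boundary, and the dilated boundary
is the dilation of \<open>E\<close> without the inner parallel set of \<open>E\<close>. By the Brunn--Minkowski inequality
with a ball as one summand (\<open>measure_nbhd_ge_ball\<close>) the dilation is smallest and the inner
parallel set largest when \<open>E\<close> is a ball. That inequality is proved here by polarization: reflecting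
mass across a hyperplane preserves volume, does not increase the volume of dilations, and for a
suitable hyperplane strictly increases the overlap with a ball that is not yet filled; a compactness argument then reaches the
ball.

Polarization also settles the equality case (\<open>convex_minimal_dilation_is_ball\<close>). If the dilation
of a convex body has minimal volume, no polarization can change the volume of its dilations at smaller
scales. For the
reflection that exchanges two points slightly outside the body, each on the normal ray of a boundary
point, this is possible only if the boundary points are exchanged as well. Hence differences of
normals are parallel to differences of boundary points, and the body is a ball.

Compactness comes from the Blaschke selection theorem and from the observation that a long convex
set has a large dilation. It turns uniqueness into stability (\<open>ball_stability\<close>), which is applied
to the rescaled minimizers after comparing their energy with that of a ball
(\<open>minimizer_dilation_bound\<close>). The existence of minimizers follows by the direct method
(\<open>exists_minimizer\<close>): convex sets converge well enough for Fatou's lemma to apply to both terms of the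
energy.
\<close>

section \<open>Dilations of sets and Hausdorff convergence\<close>

definition nbhd :: "real \<Rightarrow> 'a::metric_space set \<Rightarrow> 'a set" where
  "nbhd e A = (\<Union>x\<in>A. ball x e)"

lemma mem_nbhd: "y \<in> nbhd e A \<longleftrightarrow> (\<exists>x\<in>A. dist x y < e)"
  by (auto simp: nbhd_def)

lemma open_nbhd [simp]: "open (nbhd e A)"
  by (auto simp: nbhd_def)

lemma nbhd_mono: "A \<subseteq> B \<Longrightarrow> d \<le> e \<Longrightarrow> nbhd d A \<subseteq> nbhd e B"
  by (force simp: mem_nbhd)

lemma subset_nbhd: "0 < e \<Longrightarrow> A \<subseteq> nbhd e A"
  by (force simp: mem_nbhd)

lemma nbhd_nbhd: "nbhd d (nbhd e A) \<subseteq> nbhd (d + e) A"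
proof
  fix y assume "y \<in> nbhd d (nbhd e A)"
  then obtain x z where "x \<in> A" "dist x z < e" "dist z y < d"
    by (auto simp: mem_nbhd)
  then show "y \<in> nbhd (d + e) A"
    using dist_triangle[of x y z] by (force simp: mem_nbhd)
qed

lemma nbhd_closure: "nbhd e (closure A) = nbhd e A"
proof
  show "nbhd e (closure A) \<subseteq> nbhd e A"
  proof
    fix y assume "y \<in> nbhd e (closure A)"
    then obtain x where x: "x \<in> closure A" "dist x y < e" by (auto simp: mem_nbhd)
    then obtain a where "a \<in> A" "dist a x < e - dist x y"
      by (metis closure_approachable diff_gt_0_iff_gt)
    then have "dist a y < e" using dist_triangle[of a y x] by linarith
    then show "y \<in> nbhd e A" using \<open>a \<in> A\<close> by (auto simp: mem_nbhd)
  qed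
qed (simp add: closure_subset nbhd_mono)

lemma bounded_nbhd:
  fixes A :: "'a::real_normed_vector set"
  assumes "bounded A" shows "bounded (nbhd e A)"
proof -
  obtain B where B: "\<And>x. x \<in> A \<Longrightarrow> norm x \<le> B" using assms by (auto simp: bounded_iff)
  have "norm y \<le> B + e" if y: "y \<in> nbhd e A" for y
  proof -
    obtain x where "x \<in> A" "dist x y < e" using y by (auto simp: mem_nbhd)
    then show ?thesis using B[of x] norm_triangle_sub[of y x] by (auto simp: dist_norm norm_minus_commute)
  qed
  then show ?thesis by (auto simp: bounded_iff)
qed

lemma nbhd_translation:
  fixes A :: "'a::real_normed_vector set"
  shows "nbhd e ((+) t ` A) = (+) t ` nbhd e A"
  unfolding nbhd_def image_UN image_image by (simp only: image_add_ball) (simp only: add.commute)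

lemma lmeasurable_nbhd [simp]:
  fixes A :: "'a::euclidean_space set"
  shows "bounded A \<Longrightarrow> nbhd e A \<in> lmeasurable"
  by (simp add: bounded_nbhd lmeasurable_open)

lemma nbhd_ball:
  fixes x0 :: "'a::euclidean_space"
  assumes "0 < R" "0 < r"
  shows "nbhd r (ball x0 R) = ball x0 (R + r)"
proof
  show "nbhd r (ball x0 R) \<subseteq> ball x0 (R + r)"
  proof
    fix y assume "y \<in> nbhd r (ball x0 R)"
    then obtain x where "dist x0 x < R" "dist x y < r" by (auto simp: mem_nbhd)
    then show "y \<in> ball x0 (R + r)" using dist_triangle[of x0 y x] by auto
  qed
  show "ball x0 (R + r) \<subseteq> nbhd r (ball x0 R)"
  proof
    fix y assume y: "y \<in> ball x0 (R + r)"
    define t where "t = R / (R + r)"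
    define x where "x = x0 + t *\<^sub>R (y - x0)"
    have t: "0 < t" "t < 1" "1 - t = r / (R + r)" using assms by (auto simp: t_def field_simps)
    have d: "norm (y - x0) < R + r" using y by (simp add: dist_norm norm_minus_commute)
    have "dist x0 x = t * norm (y - x0)" using t by (simp add: x_def dist_norm)
    also have "\<dots> < t * (R + r)" using d t by simp
    also have "\<dots> = R" using assms by (simp add: t_def)
    finally have 1: "dist x0 x < R" .
    have "y - x = (1 - t) *\<^sub>R (y - x0)" by (simp add: x_def algebra_simps)
    then have "norm (y - x) = (1 - t) * norm (y - x0)" using t(2) by simp
    then have "dist x y = (1 - t) * norm (y - x0)" by (simp add: dist_norm norm_minus_commute)
    also have "\<dots> < (1 - t) * (R + r)" using d t(2) by (intro mult_strict_left_mono) auto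
    also have "\<dots> = r" using assms t by simp
    finally show "y \<in> nbhd r (ball x0 R)" using 1 by (auto simp: mem_nbhd)
  qed
qed

lemma nbhd_cball:
  fixes x0 :: "'a::euclidean_space"
  assumes "0 < R" "0 < r"
  shows "nbhd r (cball x0 R) = ball x0 (R + r)"
  using nbhd_closure[of r "ball x0 R"] nbhd_ball[OF assms, of x0] assms by simp

text \<open>Convergence in the Hausdorff metric, in terms of dilations because only the volumes of dilations are
estimated later.\<close>

definition hconv :: "(nat \<Rightarrow> 'a::metric_space set) \<Rightarrow> 'a set \<Rightarrow> bool" where
  "hconv K L \<longleftrightarrow> (\<forall>e>0. \<forall>\<^sub>F i in sequentially. L \<subseteq> nbhd e (K i) \<and> K i \<subseteq> nbhd e L)"

lemma hconvD:
  assumes "hconv K L" "0 < e"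
  shows "\<forall>\<^sub>F i in sequentially. L \<subseteq> nbhd e (K i) \<and> K i \<subseteq> nbhd e L"
  using assms by (auto simp: hconv_def)

text \<open>The distance functions to the sets \<open>K i\<close> are 1-Lipschitz and uniformly bounded on the ball, so by
Arzela--Ascoli a subsequence converges uniformly to some \<open>g\<close>; the Hausdorff limit is the zero
set of \<open>g\<close>. The polarization argument below applies this to sets that are not convex.\<close>

theorem blaschke_selection:
  fixes K :: "nat \<Rightarrow> 'a::euclidean_space set"
  assumes ne: "\<And>i. K i \<noteq> {}" and sub: "\<And>i. K i \<subseteq> cball 0 M"
  obtains L \<phi> where "strict_mono (\<phi> :: nat \<Rightarrow> nat)" "compact L" "L \<noteq> {}" "L \<subseteq> cball 0 M"
    "hconv (K \<circ> \<phi>) L"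
proof -
  let ?S = "cball (0::'a) M"
  have bnd: "norm (infdist x (K n)) \<le> 2 * M" if "x \<in> ?S" for n x
  proof -
    obtain a where a: "a \<in> K n" using ne by blast
    then have "norm a \<le> M" using sub[of n] by auto
    then have "dist x a \<le> 2 * M" using that norm_triangle_ineq4[of x a] by (simp add: dist_norm)
    then show ?thesis using infdist_le[OF a, of x] infdist_nonneg[of x "K n"] by simp
  qed
  have equi: "\<exists>d. 0 < d \<and> (\<forall>n y. y \<in> ?S \<and> norm (x - y) < d \<longrightarrow> norm (infdist x (K n) - infdist y (K n)) < e)"
    if "x \<in> ?S" "0 < e" for x and e :: real
    using infdist_triangle_abs[of x] that
    by (intro exI[of _ e]) (auto simp: dist_norm intro: le_less_trans)
  obtain g \<phi> where g: "continuous_on ?S g" and \<phi>: "strict_mono (\<phi> :: nat \<Rightarrow> nat)"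
    and lim: "\<And>e. 0 < e \<Longrightarrow> \<exists>N. \<forall>n x. n \<ge> N \<and> x \<in> ?S \<longrightarrow> norm (infdist x (K (\<phi> n)) - g x) < e"
    using Arzela_Ascoli[OF compact_cball, of 0 M "\<lambda>n x. infdist x (K n)", OF bnd equi] by metis
  define L where "L = {x \<in> ?S. g x = 0}"
  have clL: "compact L"
  proof -
    have "closedin (top_of_set ?S) {x \<in> ?S. g x = 0}"
      by (rule continuous_closedin_preimage_constant[OF g])
    then show ?thesis unfolding L_def using closedin_compact compact_cball by blast
  qed
  have gpos: "0 \<le> g x" if x: "x \<in> ?S" for x
  proof (rule ccontr)
    assume "\<not> 0 \<le> g x"
    then obtain N where "norm (infdist x (K (\<phi> N)) - g x) < - g x"
      using lim[of "- g x"] x by (meson neg_0_less_iff_less not_le order_refl)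
    then show False using infdist_nonneg[of x "K (\<phi> N)"] by auto
  qed
  have L1: "\<forall>\<^sub>F i in sequentially. L \<subseteq> nbhd e (K (\<phi> i))" if e: "0 < e" for e
  proof -
    obtain N where N: "\<And>n x. n \<ge> N \<Longrightarrow> x \<in> ?S \<Longrightarrow> norm (infdist x (K (\<phi> n)) - g x) < e"
      using lim[OF e] by blast
    have "L \<subseteq> nbhd e (K (\<phi> n))" if "n \<ge> N" for n
    proof
      fix x assume "x \<in> L"
      then have "infdist x (K (\<phi> n)) < e" using N[OF that, of x] by (auto simp: L_def)
      then obtain a where "a \<in> K (\<phi> n)" "dist x a < e"
        using ne[of "\<phi> n"] infdist_notempty[OF ne, of x "\<phi> n"]
        by (metis (no_types, lifting) cINF_less_iff bdd_belowI2 zero_le_dist)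
      then show "x \<in> nbhd e (K (\<phi> n))" by (auto simp: mem_nbhd dist_commute)
    qed
    then show ?thesis by (auto simp: eventually_sequentially)
  qed
  have L2: "\<forall>\<^sub>F i in sequentially. K (\<phi> i) \<subseteq> nbhd e L" if "0 < e" for e
  proof (cases "?S - nbhd e L = {}")
    case True
    then show ?thesis using sub by (auto intro!: always_eventually)
  next
    case False
    \<comment> \<open>Away from its zero set the limit function has a positive minimum, which eventually
      exceeds the uniform error; so no \<open>K (\<phi> n)\<close> can reach that far from \<open>L\<close>.\<close>
    have "compact (?S - nbhd e L)" by (simp add: compact_diff)
    moreover have "continuous_on (?S - nbhd e L) g" using g continuous_on_subset by blast
    ultimately obtain z where z: "z \<in> ?S - nbhd e L" "\<And>x. x \<in> ?S - nbhd e L \<Longrightarrow> g z \<le> g x"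
      using continuous_attains_inf[of "?S - nbhd e L" g] False by blast
    have "z \<notin> L" using z(1) subset_nbhd[OF that, of L] by auto
    then have "0 < g z" using gpos[of z] z(1) by (auto simp: L_def less_le)
    then obtain N where N: "\<And>n x. n \<ge> N \<Longrightarrow> x \<in> ?S \<Longrightarrow> norm (infdist x (K (\<phi> n)) - g x) < g z"
      using lim by blast
    have "K (\<phi> n) \<subseteq> nbhd e L" if "n \<ge> N" for n
    proof
      fix x assume x: "x \<in> K (\<phi> n)"
      then have "g x < g z" using N[OF that, of x] sub[of "\<phi> n"] by auto
      then show "x \<in> nbhd e L" using z(2)[of x] x sub[of "\<phi> n"] by force
    qed
    then show ?thesis by (auto simp: eventually_sequentially)
  qed
  have "hconv (K \<circ> \<phi>) L"
    unfolding hconv_def using L1 L2 by (auto intro: eventually_conj)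
  moreover have "L \<noteq> {}"
  proof
    assume "L = {}"
    then have "\<forall>\<^sub>F i in sequentially. K (\<phi> i) = {}" using L2[of 1] by (simp add: nbhd_def)
    then show False using ne by simp
  qed
  moreover have "L \<subseteq> cball 0 M" by (auto simp: L_def)
  ultimately show ?thesis using that \<phi> clL by blast
qed

lemma hconv_convex:
  fixes K :: "nat \<Rightarrow> 'a::euclidean_space set"
  assumes h: "hconv K L" and cv: "\<And>i. convex (K i)" and L: "closed L" "L \<noteq> {}"
  shows "convex L"
proof (rule convexI)
  fix x y u v assume xy: "x \<in> L" "y \<in> L" and uv: "0 \<le> u" "0 \<le> v" "u + v = (1::real)"
  let ?z = "u *\<^sub>R x + v *\<^sub>R y"
  have "\<exists>w\<in>L. dist w ?z < e" if e: "0 < e" for e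
  proof -
    obtain i where i: "L \<subseteq> nbhd (e/2) (K i)" "K i \<subseteq> nbhd (e/2) L"
      using eventually_happens[OF hconvD[OF h, of "e/2"]] e by auto
    obtain a b where a: "a \<in> K i" "norm (a - x) < e/2" and b: "b \<in> K i" "norm (b - y) < e/2"
      using i(1) xy by (auto simp: mem_nbhd dist_norm subset_iff) metis
    let ?c = "u *\<^sub>R a + v *\<^sub>R b"
    have c: "?c \<in> K i" using cv[of i] a b uv by (simp add: convexD)
    obtain w where w: "w \<in> L" "dist w ?c < e/2" using c i(2) by (auto simp: mem_nbhd subset_iff) 
    have "norm (?c - ?z) = norm (u *\<^sub>R (a - x) + v *\<^sub>R (b - y))" by (simp add: algebra_simps)
    also have "\<dots> \<le> u * norm (a - x) + v * norm (b - y)" 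
      using norm_triangle_ineq[of "u *\<^sub>R (a - x)" "v *\<^sub>R (b - y)"] uv by simp
    also have "\<dots> \<le> u * (e/2) + v * (e/2)" using a b uv by (intro add_mono mult_left_mono) auto
    also have "\<dots> = e/2" using uv by (metis distrib_right mult_1)
    finally show ?thesis using w dist_triangle[of w ?z ?c] by (intro bexI[of _ w]) (auto simp: dist_norm)
  qed
  then have "?z \<in> closure L" by (auto simp: closure_approachable)
  then show "?z \<in> L" using L by simp
qed

lemma hconv_eventually_bounded:
  "hconv K L \<Longrightarrow> bounded L \<Longrightarrow> \<forall>\<^sub>F i in sequentially. bounded (K i)" for L :: "'a::euclidean_space set"
  using hconvD[of K L 1] bounded_nbhd[of L 1] by (auto elim!: eventually_mono intro: bounded_subset)

lemma Inter_nbhd_closed: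
  fixes L :: "'a::metric_space set"
  assumes "closed L"
  shows "(\<Inter>i. nbhd (1 / real (Suc i)) L) = L"
proof
  show "(\<Inter>i. nbhd (1 / real (Suc i)) L) \<subseteq> L"
  proof
    fix x assume x: "x \<in> (\<Inter>i. nbhd (1 / real (Suc i)) L)"
    have "\<exists>y\<in>L. dist y x < e" if e: "0 < e" for e
    proof -
      obtain n where "1 / real (Suc n) < e" using nat_approx_posE[OF e] by auto
      moreover have "x \<in> nbhd (1 / real (Suc n)) L" using x by blast
      ultimately show ?thesis by (auto simp: mem_nbhd intro: less_trans)
    qed
    then have "x \<in> closure L" by (auto simp: closure_approachable)
    then show "x \<in> L" using assms by simp
  qed
  show "L \<subseteq> (\<Inter>i. nbhd (1 / real (Suc i)) L)" by (auto intro!: subset_nbhd[THEN subsetD])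
qed

text \<open>Volume can only jump up in a Hausdorff limit: the sets \<open>K i\<close> eventually lie in every dilation of
\<open>L\<close>, and these dilations shrink to \<open>L\<close> because \<open>L\<close> is closed.\<close>

lemma measure_usc_hconv:
  fixes L :: "'a::euclidean_space set"
  assumes h: "hconv K L" and L: "compact L" and C: "closed C"
    and v: "\<forall>\<^sub>F i in sequentially. v \<le> measure lebesgue (K i \<inter> C)"
    and K: "\<And>i. K i \<in> sets lebesgue"
  shows "v \<le> measure lebesgue (L \<inter> C)"
proof -
  let ?A = "\<lambda>i. nbhd (1 / real (Suc i)) L \<inter> C"
  have bL: "bounded L" using L compact_imp_bounded by blast
  have meas: "?A i \<in> lmeasurable" for i
    using bL C by (intro fmeasurable_Int_fmeasurable) auto
  have "(\<lambda>i. measure lebesgue (?A i)) \<longlonglongrightarrow> measure lebesgue (\<Inter>i. ?A i)"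
  proof (rule Lim_measure_decseq)
    show "range ?A \<subseteq> sets lebesgue" using meas by (auto dest: fmeasurableD)
    show "decseq ?A" unfolding decseq_def
      by (intro allI impI Int_mono nbhd_mono order_refl) (simp add: frac_le)
    show "emeasure lebesgue (?A i) \<noteq> \<infinity>" for i using meas[of i] by (auto simp: fmeasurable_def)
  qed
  moreover have "(\<Inter>i. ?A i) = L \<inter> C"
    using Inter_nbhd_closed[of L] L compact_imp_closed by blast
  ultimately have lim: "(\<lambda>i. measure lebesgue (?A i)) \<longlonglongrightarrow> measure lebesgue (L \<inter> C)" by simp
  have "v \<le> measure lebesgue (?A n)" for n
  proof -
    have "\<forall>\<^sub>F i in sequentially. v \<le> measure lebesgue (K i \<inter> C) \<and> K i \<subseteq> nbhd (1 / real (Suc n)) L"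
      using eventually_conj[OF v hconvD[OF h, of "1 / real (Suc n)"]] by (auto elim: eventually_mono)
    then obtain i where i: "v \<le> measure lebesgue (K i \<inter> C)" "K i \<subseteq> nbhd (1 / real (Suc n)) L"
      using eventually_happens'[OF sequentially_bot] by blast
    have "measure lebesgue (K i \<inter> C) \<le> measure lebesgue (?A n)"
      using i(2) K[of i] C meas[of n] by (intro measure_mono_fmeasurable) auto
    then show ?thesis using i(1) by linarith
  qed
  then show ?thesis using lim by (intro Lim_bounded2) auto
qed

text \<open>The volume of the open dilation at a fixed scale, on the other hand, can only drop in the limit: a
slightly smaller dilation of \<open>L\<close> is eventually contained in the dilation of \<open>K i\<close>, and the
smaller dilations exhaust \<open>nbhd r L\<close> because balls are open.\<close>

lemma measure_nbhd_lsc_hconv: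
  fixes L :: "'a::euclidean_space set"
  assumes h: "hconv K L" and L: "bounded L"
    and v: "\<And>d. 0 < d \<Longrightarrow> \<forall>\<^sub>F i in sequentially. measure lebesgue (nbhd r (K i)) \<le> v + d"
  shows "measure lebesgue (nbhd r L) \<le> v"
proof (rule field_le_epsilon)
  fix d :: real assume d: "0 < d"
  let ?A = "\<lambda>n. nbhd (r - 1 / real (Suc n)) L"
  have Un: "(\<Union>n. ?A n) = nbhd r L"
  proof
    show "(\<Union>n. ?A n) \<subseteq> nbhd r L" by (intro UN_least nbhd_mono) auto
    show "nbhd r L \<subseteq> (\<Union>n. ?A n)"
    proof
      fix y assume "y \<in> nbhd r L"
      then obtain x where x: "x \<in> L" "dist x y < r" by (auto simp: mem_nbhd)
      then obtain n where "1 / real (Suc n) < r - dist x y"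
        using nat_approx_posE[of "r - dist x y"] by auto
      then have "dist x y < r - 1 / real (Suc n)" by linarith
      then show "y \<in> (\<Union>n. ?A n)" using x(1) by (auto simp: mem_nbhd)
    qed
  qed
  have fin: "nbhd r L \<in> lmeasurable" using L by simp
  have "(\<lambda>n. measure lebesgue (?A n)) \<longlonglongrightarrow> measure lebesgue (\<Union>n. ?A n)"
  proof (rule Lim_measure_incseq)
    show "incseq ?A" unfolding incseq_def
      by (intro allI impI nbhd_mono order_refl) (simp add: frac_le)
    show "emeasure lebesgue (\<Union>n. ?A n) \<noteq> \<infinity>" unfolding Un using fin by (auto simp: fmeasurable_def)
  qed auto
  then have lim: "(\<lambda>n. measure lebesgue (?A n)) \<longlonglongrightarrow> measure lebesgue (nbhd r L)" by (simp only: Un)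
  have "measure lebesgue (?A n) \<le> v + d" for n
  proof -
    have "\<forall>\<^sub>F i in sequentially. measure lebesgue (nbhd r (K i)) \<le> v + d \<and> L \<subseteq> nbhd (1 / real (Suc n)) (K i) \<and> bounded (K i)"
      using eventually_conj[OF v[OF d] eventually_conj[OF hconvD[OF h, of "1 / real (Suc n)"] hconv_eventually_bounded[OF h L]]] 
      by (auto elim: eventually_mono)
    then obtain i where i: "measure lebesgue (nbhd r (K i)) \<le> v + d" "L \<subseteq> nbhd (1 / real (Suc n)) (K i)" "bounded (K i)"
      using eventually_happens'[OF sequentially_bot] by blast
    have "?A n \<subseteq> nbhd r (K i)"
      using nbhd_mono[OF i(2) order_refl] nbhd_nbhd[of "r - 1 / real (Suc n)" "1 / real (Suc n)" "K i"] by auto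
    then have "measure lebesgue (?A n) \<le> measure lebesgue (nbhd r (K i))"
      using i(3) by (intro measure_mono_fmeasurable) auto
    then show ?thesis using i(1) by linarith
  qed
  then show "measure lebesgue (nbhd r L) \<le> v + d" using lim by (intro Lim_bounded) auto
qed

section \<open>Reflections and polarization\<close>

text \<open>Half the difference of the squared distances of \<open>x\<close> to \<open>q\<close> and to \<open>p\<close>: its zero set is the
perpendicular bisector of \<open>p\<close> and \<open>q\<close>, and it is positive on the side of \<open>p\<close>.\<close>

definition side :: "'a::real_inner \<Rightarrow> 'a \<Rightarrow> 'a \<Rightarrow> real" where
  "side p q x = (p - q) \<bullet> x - (p \<bullet> p - q \<bullet> q) / 2"

text \<open>The reflection in the perpendicular bisector of \<open>p\<close> and \<open>q\<close>.\<close>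

definition mirror :: "'a::real_inner \<Rightarrow> 'a \<Rightarrow> 'a \<Rightarrow> 'a" where
  "mirror p q x = x - (2 * side p q x / ((p - q) \<bullet> (p - q))) *\<^sub>R (p - q)"

lemma side_dist: "side p q x = ((dist x q)\<^sup>2 - (dist x p)\<^sup>2) / 2"
  by (simp add: side_def dist_norm power2_norm_eq_inner inner_diff inner_commute field_simps)

lemma side_mirror:
  assumes "p \<noteq> q" shows "side p q (mirror p q x) = - side p q x"
proof -
  have "(p - q) \<bullet> (p - q) \<noteq> 0" using assms by simp
  then have "(p - q) \<bullet> mirror p q x = (p - q) \<bullet> x - 2 * side p q x"
    unfolding mirror_def by (simp add: inner_diff_right del: inner_eq_zero_iff)
  then show ?thesis unfolding side_def[of p q "mirror p q x"] by (simp add: side_def field_simps)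
qed

lemma mirror_mirror [simp]:
  assumes "p \<noteq> q" shows "mirror p q (mirror p q x) = x"
  unfolding mirror_def[of p q "mirror p q x"] side_mirror[OF assms] by (simp add: mirror_def)

lemma dist_mirror_sq:
  assumes "p \<noteq> q"
  shows "(dist x (mirror p q y))\<^sup>2 = (dist x y)\<^sup>2 + 4 * side p q x * side p q y / ((p - q) \<bullet> (p - q))"
proof -
  let ?a = "p - q" let ?c = "2 * side p q y / ((p - q) \<bullet> (p - q))"
  have n: "?a \<bullet> ?a \<noteq> 0" using assms by simp
  have "x - mirror p q y = (x - y) + ?c *\<^sub>R ?a" by (simp add: mirror_def)
  then have "(dist x (mirror p q y))\<^sup>2 = ((x - y) + ?c *\<^sub>R ?a) \<bullet> ((x - y) + ?c *\<^sub>R ?a)"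
    unfolding dist_norm power2_norm_eq_inner by (simp only:)
  also have "\<dots> = (x - y) \<bullet> (x - y) + 2 * ?c * (?a \<bullet> (x - y)) + ?c * ?c * (?a \<bullet> ?a)"
  proof -
    have "(u + c *\<^sub>R a) \<bullet> (u + c *\<^sub>R a) = u \<bullet> u + 2 * c * (a \<bullet> u) + c * c * (a \<bullet> a)" for u a :: 'a and c
      by (simp add: inner_add_left inner_add_right inner_commute[of u a] algebra_simps)
    then show ?thesis .
  qed
  also have "\<dots> = (dist x y)\<^sup>2 + 2 * ?c * (side p q x - side p q y) + 2 * ?c * side p q y"
  proof -
    have "?c * (?a \<bullet> ?a) = 2 * side p q y" using n by (simp del: inner_eq_zero_iff)
    then have "?c * ?c * (?a \<bullet> ?a) = 2 * ?c * side p q y" by (simp only: mult.assoc)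
    moreover have "?a \<bullet> (x - y) = side p q x - side p q y" by (simp add: side_def inner_diff_right)
    ultimately show ?thesis by (simp only: dist_norm power2_norm_eq_inner)
  qed
  also have "\<dots> = (dist x y)\<^sup>2 + 4 * side p q x * side p q y / (?a \<bullet> ?a)"
    by (simp only: times_divide_eq_right times_divide_eq_left add.assoc add_divide_distrib[symmetric]) (simp add: algebra_simps)
  finally show ?thesis .
qed

lemma dist_mirror [simp]:
  assumes "p \<noteq> q" shows "dist (mirror p q x) (mirror p q y) = dist x y"
proof -
  have "(dist (mirror p q x) (mirror p q y))\<^sup>2 = (dist x y)\<^sup>2"
    using dist_mirror_sq[OF assms, of "mirror p q x" y] dist_mirror_sq[OF assms, of y x]
    by (simp add: side_mirror assms dist_commute)
  then show ?thesis by simp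
qed

lemma dist_mirror_swap: "p \<noteq> q \<Longrightarrow> dist (mirror p q x) y = dist x (mirror p q y)"
  using dist_mirror[of p q x "mirror p q y"] by simp

text \<open>The basic fact behind polarization: two points on the same side of a hyperplane are not farther
apart than one of them is from the mirror image of the other.\<close>

lemma dist_le_dist_mirror:
  assumes "p \<noteq> q" "0 \<le> side p q x * side p q y"
  shows "dist x y \<le> dist x (mirror p q y)"
proof (rule power2_le_imp_le)
  have "0 \<le> 4 * (side p q x * side p q y) / ((p - q) \<bullet> (p - q))"
    using assms by (intro divide_nonneg_nonneg) auto
  then show "(dist x y)\<^sup>2 \<le> (dist x (mirror p q y))\<^sup>2"
    unfolding dist_mirror_sq[OF assms(1)] by (simp add: mult.assoc)
qed simp

lemma mirror_left: "p \<noteq> q \<Longrightarrow> mirror p q p = q"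
proof -
  assume "p \<noteq> q"
  moreover have "side p q p = (p - q) \<bullet> (p - q) / 2"
    by (simp add: side_def inner_diff inner_commute field_simps)
  moreover have "(p - q) \<bullet> (p - q) \<noteq> 0" using \<open>p \<noteq> q\<close> by simp
  ultimately have "2 * side p q p / ((p - q) \<bullet> (p - q)) = 1" by simp
  then show ?thesis by (simp only: mirror_def scaleR_one) simp
qed

lemma mirror_right: "p \<noteq> q \<Longrightarrow> mirror p q q = p"
  using mirror_left[of p q] mirror_mirror[of p q p] by simp

lemma continuous_on_side [continuous_intros]: "continuous_on S (side p q)"
  unfolding side_def by (intro continuous_intros)

lemma continuous_on_mirror [continuous_intros]: "continuous_on S (mirror p q)"
  unfolding mirror_def by (cases "p = q") (auto intro!: continuous_intros)

lemma borel_measurable_mirror [measurable]: "mirror p q \<in> borel_measurable (borel :: 'a::euclidean_space measure)"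
  by (intro borel_measurable_continuous_onI continuous_on_mirror)

text \<open>By the Vitali covering theorem an open set consists, up to a null set, of countably many disjoint
balls, and an isometry carries each of them to a ball of the same radius, hence of the same volume.\<close>

lemma emeasure_open_le_isometry:
  fixes f :: "'a::euclidean_space \<Rightarrow> 'a"
  assumes iso: "\<And>x y. dist (f x) (f y) = dist x y" and inv: "\<And>x. f (f x) = x" and S: "open S"
  shows "emeasure lborel S \<le> emeasure lborel (f -` S)"
proof -
  have fb: "f -` ball c r = ball (f c) r" for c r
    using iso inv by (auto simp: set_eq_iff) (metis+)
  have cont: "continuous_on UNIV f"
    using iso by (auto simp: continuous_on_iff)
  have Sf: "open (f -` S)" using S cont by (simp add: continuous_on_open_vimage)
  let ?K = "{(c, r). ball c r \<subseteq> S}"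
  obtain C where C: "countable C" "C \<subseteq> ?K"
     "pairwise (\<lambda>i j. disjnt (ball (fst i) (snd i)) (ball (fst j) (snd j))) C"
     "negligible (S - (\<Union>i\<in>C. ball (fst i) (snd i)))"
  proof (rule Vitali_covering_theorem_balls[of S ?K fst snd])
    fix x and d :: real assume "x \<in> S" "0 < d"
    then obtain e where "0 < e" "ball x e \<subseteq> S" using S openE by blast
    then show "\<exists>i. i \<in> ?K \<and> x \<in> ball (fst i) (snd i) \<and> snd i < d"
      using \<open>0 < d\<close> by (intro exI[of _ "(x, min e (d/2))"]) auto
  qed
  let ?B = "\<lambda>i. ball (fst i) (snd i) :: 'a set" let ?U = "\<Union>i\<in>C. ?B i"
  have dis: "disjoint_family_on ?B C"
    using C(3) by (auto simp: disjoint_family_on_def pairwise_def disjnt_def)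
  have dis': "disjoint_family_on (\<lambda>i. f -` ?B i) C"
    using dis by (fastforce simp: disjoint_family_on_def)
  have N: "S - ?U \<in> null_sets lborel"
    using C(4) S by (simp add: negligible_iff_null_sets null_sets_completion_iff open_UN)
  have "emeasure lborel S \<le> emeasure lborel (?U \<union> (S - ?U))"
    using S by (intro emeasure_mono) (auto intro!: sets.countable_UN' C)
  also have "\<dots> = emeasure lborel ?U"
    using N by (intro emeasure_Un_null_set) (auto intro!: sets.countable_UN' C)
  also have "\<dots> = (\<integral>\<^sup>+i. emeasure lborel (?B i) \<partial>count_space C)"
    by (rule emeasure_UN_countable) (use dis C in auto)
  also have "\<dots> = (\<integral>\<^sup>+i. emeasure lborel (f -` ?B i) \<partial>count_space C)"
  proof (rule nn_integral_cong)
    fix i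
    show "emeasure lborel (?B i) = emeasure lborel (f -` ?B i)"
    proof (cases "0 \<le> snd i")
      case True then show ?thesis unfolding fb by (simp add: emeasure_ball)
    next
      case False
      then have "ball x (snd i) = {}" for x :: 'a by simp
      then show ?thesis by (simp only: vimage_empty)
    qed
  qed
  also have "\<dots> = emeasure lborel (\<Union>i\<in>C. f -` ?B i)"
    by (rule emeasure_UN_countable[symmetric]) (use dis' C fb in auto)
  also have "\<dots> \<le> emeasure lborel (f -` S)"
    using Sf C(2) by (intro emeasure_mono) (auto, force)
  finally show ?thesis .
qed

text \<open>Applying the preceding inequality to \<open>S\<close> and to \<open>f -` S\<close> gives equality for open sets, in
particular for boxes, and boxes determine Lebesgue measure.\<close>

lemma distr_lborel_isometry:
  fixes f :: "'a::euclidean_space \<Rightarrow> 'a"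
  assumes iso: "\<And>x y. dist (f x) (f y) = dist x y" and inv: "\<And>x. f (f x) = x"
  shows "distr lborel borel f = lborel"
proof (rule lborel_eqI[symmetric])
  have cont: "continuous_on UNIV f"
    using iso by (auto simp: continuous_on_iff)
  then have m: "f \<in> borel_measurable borel" by (rule borel_measurable_continuous_onI)
  fix l u :: 'a assume lu: "\<And>b. b \<in> Basis \<Longrightarrow> l \<bullet> b \<le> u \<bullet> b"
  have "f -` (f -` box l u) = box l u" by (auto simp: inv)
  moreover have "open (f -` box l u)" by (rule open_vimage[OF open_box cont])
  ultimately have "emeasure lborel (f -` box l u) = emeasure lborel (box l u)"
    using emeasure_open_le_isometry[OF iso inv, of "box l u"] emeasure_open_le_isometry[OF iso inv, of "f -` box l u"] open_box[of l u]
    by simp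
  then show "emeasure (distr lborel borel f) (box l u) = ennreal (\<Prod>b\<in>Basis. (u - l) \<bullet> b)"
    using lu m by (simp add: emeasure_distr emeasure_lborel_box)
qed simp

lemma emeasure_mirror_vimage:
  fixes S :: "'a::euclidean_space set"
  assumes "p \<noteq> q" "S \<in> sets borel"
  shows "emeasure lborel (mirror p q -` S) = emeasure lborel S"
proof -
  have "emeasure (distr lborel borel (mirror p q)) S = emeasure lborel S"
    using assms by (subst distr_lborel_isometry) auto
  then show ?thesis using assms by (simp add: emeasure_distr)
qed

text \<open>Two-point symmetrization (polarization): within each pair of mirror points, whatever mass of \<open>A\<close>
there is gets moved to the side of \<open>q\<close>. Points of the mirror hyperplane equal their images, so
both clauses agree there; taking both half-spaces closed makes the operation preserve closed sets.\<close>

definition polar :: "'a::real_inner \<Rightarrow> 'a \<Rightarrow> 'a set \<Rightarrow> 'a set" where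
  "polar p q A = (A \<union> mirror p q -` A) \<inter> {x. side p q x \<le> 0} \<union> (A \<inter> mirror p q -` A) \<inter> {x. 0 \<le> side p q x}"

lemma closed_polar:
  assumes "closed A" shows "closed (polar p q A)"
proof -
  have "closed (mirror p q -` A)"
    using assms continuous_on_mirror[of UNIV p q] by (simp add: continuous_on_closed_vimage)
  moreover have "closed {x. side p q x \<le> 0}" "closed {x. 0 \<le> side p q x}"
    by (intro closed_Collect_le continuous_intros)+
  ultimately show ?thesis using assms unfolding polar_def by (intro closed_Un closed_Int)
qed

lemma borel_polar:
  fixes A :: "'a::euclidean_space set"
  assumes [measurable]: "A \<in> sets borel" shows "polar p q A \<in> sets borel"
proof -
  have [measurable]: "mirror p q -` A \<in> sets borel"
    using measurable_sets[OF borel_measurable_mirror assms, of p q] by simp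
  have [measurable]: "{x. side p q x \<le> 0} \<in> sets borel" "{x. 0 \<le> side p q x} \<in> sets borel"
    by (auto intro!: borel_closed closed_Collect_le continuous_intros)
  show ?thesis unfolding polar_def by measurable
qed

text \<open>Polarization turns the traces of \<open>A\<close> and of its mirror image on one half-space into their union and
their intersection, and measure is modular.\<close>

lemma emeasure_polar:
  fixes A :: "'a::euclidean_space set"
  assumes pq: "p \<noteq> q" and A [measurable]: "A \<in> sets borel"
  shows "emeasure lborel (polar p q A) = emeasure lborel A"
proof -
  let ?\<mu> = "emeasure lborel :: 'a set \<Rightarrow> ennreal"
  let ?H = "{x. side p q x < 0}" and ?P = "{x. 0 < side p q x}" and ?A' = "mirror p q -` A"
  have A' [measurable]: "?A' \<in> sets borel"
    using measurable_sets[OF borel_measurable_mirror A, of p q] by simp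
  have H [measurable]: "?H \<in> sets borel" and P [measurable]: "?P \<in> sets borel"
    by (auto intro!: borel_open open_Collect_less continuous_intros)
  have "negligible {x. (p - q) \<bullet> x = (p \<bullet> p - q \<bullet> q) / 2}"
    using pq by (intro negligible_hyperplane) auto
  then have Z: "{x. side p q x = 0} \<in> null_sets lborel"
    by (simp add: side_def negligible_iff_null_sets null_sets_completion_iff)
  have split: "?\<mu> S = ?\<mu> (S \<inter> ?H) + ?\<mu> (S \<inter> ?P)" if [measurable]: "S \<in> sets borel" for S
  proof -
    have "?\<mu> S = ?\<mu> (S - {x. side p q x = 0})"
      using Z that by (intro emeasure_Diff_null_set[symmetric]) auto
    also have "S - {x. side p q x = 0} = (S \<inter> ?H) \<union> (S \<inter> ?P)" by auto
    also have "?\<mu> \<dots> = ?\<mu> (S \<inter> ?H) + ?\<mu> (S \<inter> ?P)"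
      by (intro plus_emeasure[symmetric]) auto
    finally show ?thesis .
  qed
  have 1: "polar p q A \<inter> ?H = (A \<inter> ?H) \<union> (?A' \<inter> ?H)" by (auto simp: polar_def)
  have 2: "polar p q A \<inter> ?P = mirror p q -` ((A \<inter> ?H) \<inter> (?A' \<inter> ?H))"
    using pq by (auto simp: polar_def side_mirror)
  have 3: "A \<inter> ?P = mirror p q -` (?A' \<inter> ?H)" using pq by (auto simp: side_mirror)
  have "?\<mu> (polar p q A) = ?\<mu> ((A \<inter> ?H) \<union> (?A' \<inter> ?H)) + ?\<mu> ((A \<inter> ?H) \<inter> (?A' \<inter> ?H))"
  proof -
    have "?\<mu> (mirror p q -` ((A \<inter> ?H) \<inter> (?A' \<inter> ?H))) = ?\<mu> ((A \<inter> ?H) \<inter> (?A' \<inter> ?H))"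
      by (intro emeasure_mirror_vimage[OF pq]) measurable
    then show ?thesis using split[OF borel_polar[OF A, of p q]] unfolding 1 2 by simp
  qed
  also have "\<dots> = ?\<mu> (A \<inter> ?H) + ?\<mu> (?A' \<inter> ?H)"
    by (rule emeasure_Un_Int[symmetric]) auto
  also have "?\<mu> (?A' \<inter> ?H) = ?\<mu> (A \<inter> ?P)"
    unfolding 3 by (subst emeasure_mirror_vimage[OF pq]) auto
  finally show ?thesis using split[OF A] by simp
qed

lemma measure_polar:
  fixes A :: "'a::euclidean_space set"
  assumes "p \<noteq> q" "A \<in> sets borel"
  shows "measure lebesgue (polar p q A) = measure lebesgue A"
  using emeasure_polar[OF assms] borel_polar[OF assms(2)] assms by (simp add: measure_def)

text \<open>Polarization is a smoothing: it commutes with dilation up to an inclusion, so together with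
\<open>emeasure_polar\<close> it does not increase the volume of a dilation. The only case with content is a point
\<open>z\<close> on the side of \<open>p\<close> within distance \<open>e\<close> of a point \<open>x\<close> on the side of \<open>q\<close>; then the mirror
image of \<open>x\<close> is at least as close to \<open>z\<close>.\<close>

lemma nbhd_polar:
  assumes pq: "p \<noteq> q" shows "nbhd e (polar p q A) \<subseteq> polar p q (nbhd e A)"
proof
  fix z assume "z \<in> nbhd e (polar p q A)"
  then obtain x where x: "x \<in> polar p q A" and d: "dist x z < e" by (auto simp: mem_nbhd)
  have d': "dist (mirror p q x) (mirror p q z) < e" using d pq by simp
  show "z \<in> polar p q (nbhd e A)"
  proof (cases "side p q z \<le> 0")
    case True
    from x have "x \<in> A \<or> mirror p q x \<in> A" by (auto simp: polar_def)
    then have "z \<in> nbhd e A \<or> mirror p q z \<in> nbhd e A" using d d' by (auto simp: mem_nbhd)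
    then show ?thesis using True by (auto simp: polar_def)
  next
    case False
    have "z \<in> nbhd e A \<and> mirror p q z \<in> nbhd e A"
    proof (cases "x \<in> A \<and> mirror p q x \<in> A")
      case True then show ?thesis using d d' by (auto simp: mem_nbhd)
    next
      case nb: False
      then have sx: "side p q x \<le> 0" and or: "x \<in> A \<or> mirror p q x \<in> A" using x by (auto simp: polar_def)
      have "0 \<le> side p q z * side p q (mirror p q x)"
        using False sx pq by (simp add: side_mirror mult_nonneg_nonpos)
      then have "dist z (mirror p q x) \<le> dist z x" using dist_le_dist_mirror[OF pq, of z "mirror p q x"] pq by simp
      then have d2: "dist (mirror p q x) z < e" using d by (simp add: dist_commute)
      then have d3: "dist x (mirror p q z) < e" using pq by (simp add: dist_mirror_swap)
      show ?thesis using or d d' d2 d3 by (auto simp: mem_nbhd)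
    qed
    then show ?thesis using False by (auto simp: polar_def)
  qed
qed

lemma norm_le_mirror:
  assumes "p \<noteq> q" "side p q 0 \<le> 0" "side p q x \<le> 0"
  shows "norm x \<le> norm (mirror p q x)"
  using dist_le_dist_mirror[of p q 0 x] assms by (simp add: mult_nonpos_nonpos)

text \<open>If the centre of the ball lies on the favoured side, polarization does not decrease the mass that
\<open>A\<close> has inside the ball: the ball already equals its own polarization.\<close>

lemma polar_cball:
  assumes "p \<noteq> q" "side p q 0 \<le> 0"
  shows "polar p q (A \<inter> cball 0 R) \<subseteq> polar p q A \<inter> cball 0 R"
  using norm_le_mirror[OF assms] by (auto simp: polar_def) (meson order_trans)+

lemma polar_subset_cball:
  assumes "p \<noteq> q" "side p q 0 \<le> 0" "A \<subseteq> cball 0 R"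
  shows "polar p q A \<subseteq> cball 0 R"
  using polar_cball[OF assms(1,2), of A R] assms(3) by (simp add: Int_absorb2)

section \<open>The isoperimetric inequality for dilations\<close>

lemma measure_ball_eq:
  fixes c :: "'a::euclidean_space"
  assumes "0 \<le> R"
  shows "measure lebesgue (ball c R) = unit_ball_vol (real DIM('a)) * R ^ DIM('a)"
  using content_ball[OF assms, of c] by simp

lemma measure_cball_ball: "measure lebesgue (cball c R) = measure lebesgue (ball (c::'a::euclidean_space) R)"
  using content_cball_conv_ball[of c R] by simp

lemma measure_ball_mono_iff:
  fixes c d :: "'a::euclidean_space"
  assumes "0 \<le> R" "0 \<le> R'"
  shows "measure lebesgue (ball c R) \<le> measure lebesgue (ball d R') \<longleftrightarrow> R \<le> R'"
  unfolding measure_ball_eq[OF assms(1)] measure_ball_eq[OF assms(2)]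
  using assms power_mono_iff[of R R' "DIM('a)"] unit_ball_vol_pos[of "real DIM('a)"] by (simp add: mult_le_cancel_left_pos)

lemma ex_ball_measure:
  assumes "0 \<le> v"
  obtains R where "0 \<le> R" "measure lebesgue (ball (c::'a::euclidean_space) R) = v"
proof -
  let ?\<omega> = "unit_ball_vol (real DIM('a))"
  let ?R = "root DIM('a) (v / ?\<omega>)"
  have "0 < ?\<omega>" by (rule unit_ball_vol_pos) simp
  then have "0 \<le> ?R" "?R ^ DIM('a) = v / ?\<omega>" using assms by (auto intro!: real_root_pow_pos2)
  then have "measure lebesgue (ball c ?R) = v" using \<open>0 < ?\<omega>\<close> by (subst measure_ball_eq) (simp_all only: times_divide_eq_right nonzero_mult_div_cancel_left order_less_imp_not_eq2 simp_thms)
  then show ?thesis using \<open>0 \<le> ?R\<close> that by blast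
qed

lemma open_pos_measure:
  fixes U :: "'a::euclidean_space set"
  assumes "open U" "U \<noteq> {}" "U \<in> lmeasurable"
  shows "0 < measure lebesgue U"
proof -
  obtain x e where "0 < e" "ball x e \<subseteq> U" using assms by (meson all_not_in_conv openE)
  then have "0 < measure lebesgue (ball x e)" by (simp add: content_ball_pos)
  also have "\<dots> \<le> measure lebesgue U"
    using \<open>ball x e \<subseteq> U\<close> assms by (intro measure_mono_fmeasurable) auto
  finally show ?thesis .
qed

lemma locally_positive_measure_point:
  fixes A :: "'a::euclidean_space set"
  assumes A: "A \<in> lmeasurable" "0 < measure lebesgue A" and e: "0 < e"
  shows "\<exists>a\<in>A. \<not> negligible (A \<inter> ball a e)"
proof (rule ccontr)
  assume "\<not> ?thesis"
  then have n: "negligible (A \<inter> ball a e)" if "a \<in> A" for a using that by blast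
  have "\<exists>U. openin (top_of_set A) U \<and> x \<in> U \<and> negligible U" if "x \<in> A" for x
    using n[OF that] e that by (intro exI[of _ "A \<inter> ball x e"]) auto
  then have "negligible A" by (subst locally_negligible_alt) auto
  then show False using A by (simp add: negligible_iff_measure0)
qed

text \<open>If \<open>K\<close> has at least the volume of the ball but does not fill it, there is a small ball around some
\<open>q\<close> inside the big ball that misses \<open>K\<close>, and there is mass of \<open>K\<close> outside the big ball
concentrated near some \<open>p\<close>. The reflection that exchanges \<open>p\<close> and \<open>q\<close> moves that mass into the
hole. The hole is a genuine ball because \<open>K\<close> is closed.\<close>

lemma polarization_increases:
  fixes K :: "'a::euclidean_space set"
  assumes K: "compact K" and big: "measure lebesgue (cball (0::'a) R) \<le> measure lebesgue K"
    and lt: "measure lebesgue (K \<inter> cball 0 R) < measure lebesgue (cball (0::'a) R)"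
  obtains p q where "p \<noteq> q" "side p q 0 \<le> 0"
    "measure lebesgue (K \<inter> cball 0 R) < measure lebesgue (polar p q K \<inter> cball 0 R)"
proof -
  let ?B = "cball (0::'a) R" and ?\<mu> = "measure lebesgue :: 'a set \<Rightarrow> real"
  have Km: "K \<in> lmeasurable" and Kb: "K \<in> sets borel" using K by (auto simp: compact_imp_closed lmeasurable_compact)
  have "ball 0 R - K \<noteq> {}"
  proof
    assume "ball 0 R - K = {}"
    then have "?\<mu> (ball 0 R) \<le> ?\<mu> (K \<inter> ?B)"
      using Km by (intro measure_mono_fmeasurable) auto
    then show False using lt by (simp add: measure_cball_ball)
  qed
  then obtain q where q: "q \<in> ball 0 R - K" by blast
  moreover have "open (ball 0 R - K)" using K compact_imp_closed by auto
  ultimately obtain e where e: "0 < e" "ball q e \<subseteq> ball 0 R - K" using openE by blast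
  \<comment> \<open>The bound by \<open>R - norm q\<close> keeps the small ball around \<open>q\<close> on its own side of the mirror.\<close>
  define \<epsilon> where "\<epsilon> = min e (R - norm q)"
  have \<epsilon>: "0 < \<epsilon>" "ball q \<epsilon> \<subseteq> ball 0 R - K" "\<epsilon> \<le> R - norm q" using e q by (auto simp: \<epsilon>_def)
  have "?\<mu> (K - ?B) = ?\<mu> K - ?\<mu> (K \<inter> ?B)" 
    using measurable_measure_Diff[OF Km, of "K \<inter> ?B"] Kb by (auto simp: Diff_Int)
  then have "0 < ?\<mu> (K - ?B)" using big lt by linarith
  moreover have "K - ?B \<in> lmeasurable" using Km by (intro fmeasurable.Diff) auto
  ultimately obtain p where p: "p \<in> K - ?B" and pos: "\<not> negligible ((K - ?B) \<inter> ball p (\<epsilon>/2))"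
    using locally_positive_measure_point[of "K - ?B" "\<epsilon>/2"] \<epsilon> by auto
  have pq: "p \<noteq> q" and pn: "R < norm p" and qn: "norm q < R" using p q by auto
  have s0: "side p q 0 \<le> 0" 
    using pn qn by (auto simp: side_dist power_mono)
  let ?W = "(K - ?B) \<inter> ball p (\<epsilon>/2)"
  let ?V = "mirror p q -` ?W"
  have Wb: "?W \<in> sets borel" using Kb by auto
  have Vb: "?V \<in> sets borel" using measurable_sets[OF borel_measurable_mirror Wb, of p q] by simp
  have mV: "emeasure lborel ?V = emeasure lborel ?W" by (rule emeasure_mirror_vimage[OF pq Wb])
  have Vpos: "0 < ?\<mu> ?V"
  proof -
    have "?W \<in> lmeasurable" using Wb by (intro bounded_set_imp_lmeasurable) (auto intro: bounded_subset[OF bounded_ball])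
    then have "0 < ?\<mu> ?W" using pos by (simp add: negligible_iff_measure0 zero_less_measure_iff less_le)
    then show ?thesis using mV Vb Wb by (simp add: measure_def)
  qed
  have Vsub: "?V \<subseteq> ball q (\<epsilon>/2)"
  proof
    fix x assume "x \<in> ?V"
    then have "dist p (mirror p q x) < \<epsilon>/2" by auto
    then show "x \<in> ball q (\<epsilon>/2)" using pq by (simp add: dist_mirror_swap[symmetric] mirror_left)
  qed
  have Vside: "side p q x \<le> 0" if "x \<in> ?V" for x
  proof -
    have d: "dist q x < \<epsilon>/2" using Vsub that by auto
    have "\<epsilon> < dist p q" using \<epsilon>(3) pn norm_triangle_ineq2[of p q] by (simp add: dist_norm)
    then have "dist x q \<le> dist x p" using d dist_triangle[of p q x] by (simp add: dist_commute)
    then show ?thesis by (simp add: side_dist power_mono)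
  qed
  have Vin: "?V \<subseteq> polar p q K \<inter> ?B"
  proof
    fix x assume x: "x \<in> ?V"
    then have "x \<in> ball 0 R" using Vsub \<epsilon> by (force)
    then show "x \<in> polar p q K \<inter> ?B" using Vside[OF x] x by (auto simp: polar_def)
  qed
  have Vdisj: "?V \<inter> polar p q (K \<inter> ?B) = {}"
  proof -
    have "ball q (\<epsilon>/2) \<inter> K = {}" using \<epsilon> by force
    then show ?thesis using Vsub by (auto simp: polar_def)
  qed
  have m1: "polar p q (K \<inter> ?B) \<in> lmeasurable" 
    using polar_cball[OF pq s0, of K R] borel_polar[of "K \<inter> ?B" p q] Kb
    by (intro bounded_set_imp_lmeasurable) (auto intro: bounded_subset[OF bounded_cball])
  have m2: "?V \<in> lmeasurable" 
    using Vb Vsub by (intro bounded_set_imp_lmeasurable) (auto intro: bounded_subset[OF bounded_ball])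
  have m3: "polar p q K \<inter> ?B \<in> lmeasurable"
    using borel_polar[OF Kb, of p q] by (intro bounded_set_imp_lmeasurable) (auto intro: bounded_subset[OF bounded_cball])
  have "?\<mu> (K \<inter> ?B) < ?\<mu> (polar p q (K \<inter> ?B)) + ?\<mu> ?V"
    using Vpos Kb by (subst measure_polar[OF pq]) auto
  also have "\<dots> = ?\<mu> (polar p q (K \<inter> ?B) \<union> ?V)"
    using m1 m2 Vdisj by (intro measure_Union[symmetric]) (auto simp del: emeasure_completion simp: fmeasurable_def)
  also have "\<dots> \<le> ?\<mu> (polar p q K \<inter> ?B)"
    using m1 m2 m3 Vin polar_cball[OF pq s0, of K R] by (intro measure_mono_fmeasurable) auto
  finally show ?thesis using that pq s0 by blast
qed

text \<open>The Brunn--Minkowski inequality in the case where one summand is a ball. Among all compact sets of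
at least the given volume whose dilation is at most as large as that of \<open>F\<close>, one maximizes the
mass inside the ball of radius \<open>R\<close>; the maximum is attained by the selection theorem and the two
semicontinuity lemmas. By \<open>polarization_increases\<close> the maximizer contains that ball, so its
dilation contains the ball of radius \<open>R + r\<close>.\<close>

theorem measure_nbhd_ge_ball:
  fixes F :: "'a::euclidean_space set"
  assumes F: "compact F" and R: "0 < R" and r: "0 < r"
    and big: "measure lebesgue (ball (0::'a) R) \<le> measure lebesgue F"
  shows "measure lebesgue (ball (0::'a) (R + r)) \<le> measure lebesgue (nbhd r F)"
proof -
  let ?B = "cball (0::'a) R" and ?\<mu> = "measure lebesgue :: 'a set \<Rightarrow> real"
  have Bpos: "0 < ?\<mu> (ball 0 R)" using R by (simp add: content_ball_pos)
  obtain M where M: "F \<subseteq> cball 0 M" using compact_imp_bounded[OF F] by (auto simp: bounded_iff subset_iff)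
  define \<C> where "\<C> = {K. compact K \<and> K \<subseteq> cball 0 M \<and> ?\<mu> (ball 0 R) \<le> ?\<mu> K \<and> ?\<mu> (nbhd r K) \<le> ?\<mu> (nbhd r F)}"
  have F\<C>: "F \<in> \<C>" using F M big by (auto simp: \<C>_def)
  let ?f = "\<lambda>K. ?\<mu> (K \<inter> ?B)"
  have fle: "?f K \<le> ?\<mu> ?B" if "K \<in> \<C>" for K
    using that by (intro measure_mono_fmeasurable) (auto simp: \<C>_def compact_imp_closed)
  define S where "S = (SUP K\<in>\<C>. ?f K)"
  have bdd: "bdd_above (?f ` \<C>)" using fle by (auto intro!: bdd_aboveI)
  have "\<exists>K\<in>\<C>. S - 1 / real (Suc i) < ?f K" for i
  proof -
    have "S - 1 / real (Suc i) < (SUP K\<in>\<C>. ?f K)" by (simp add: S_def)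
    then show ?thesis using less_cSUP_iff[OF _ bdd] F\<C> by blast
  qed
  then obtain K where K: "\<And>i. K i \<in> \<C>" "\<And>i. S - 1 / real (Suc i) < ?f (K i)" by metis
  have Kne: "K i \<noteq> {}" for i
  proof
    assume "K i = {}"
    then have "?\<mu> (ball 0 R) \<le> 0" using K(1)[of i] by (simp add: \<C>_def)
    then show False using Bpos by linarith
  qed
  have Ksub: "K i \<subseteq> cball 0 M" for i using K(1)[of i] by (auto simp: \<C>_def)
  obtain L \<phi> where \<phi>: "strict_mono (\<phi> :: nat \<Rightarrow> nat)" and L: "compact L" "L \<noteq> {}" "L \<subseteq> cball 0 M"
    and h: "hconv (K \<circ> \<phi>) L"
    using blaschke_selection[of K M, OF Kne Ksub] by blast
  have Ks: "(K \<circ> \<phi>) i \<in> sets lebesgue" for i using K(1)[of "\<phi> i"] by (auto simp: \<C>_def compact_imp_closed)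
  have "L \<in> \<C>"
  proof -
    have "?\<mu> (ball 0 R) \<le> ?\<mu> (L \<inter> UNIV)"
      by (rule measure_usc_hconv[OF h L(1) closed_UNIV _ Ks]) (use K(1) in \<open>auto simp: \<C>_def\<close>)
    moreover have "?\<mu> (nbhd r L) \<le> ?\<mu> (nbhd r F)"
      by (rule measure_nbhd_lsc_hconv[OF h compact_imp_bounded[OF L(1)]])
         (use K(1) in \<open>auto simp: \<C>_def intro!: always_eventually add_increasing2\<close>)
    ultimately show ?thesis using L by (simp add: \<C>_def)
  qed
  have Smax: "?f K \<le> S" if "K \<in> \<C>" for K unfolding S_def using bdd that by (rule cSUP_upper2) simp
  have SL: "S \<le> ?f L"
  proof (rule field_le_epsilon)
    fix d :: real assume d: "0 < d"
    obtain N where N: "1 / real (Suc N) < d" using nat_approx_posE[OF d] by auto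
    have "\<forall>\<^sub>F i in sequentially. S - d \<le> ?f ((K \<circ> \<phi>) i)"
    proof (rule eventually_sequentiallyI)
      fix i assume "N \<le> i"
      then have "N \<le> \<phi> i" using strict_mono_imp_increasing[OF \<phi>, of i] by simp
      then have "1 / real (Suc (\<phi> i)) \<le> 1 / real (Suc N)" by (simp add: frac_le)
      then show "S - d \<le> ?f ((K \<circ> \<phi>) i)" using K(2)[of "\<phi> i"] N by simp
    qed
    then have "S - d \<le> ?f L" by (rule measure_usc_hconv[OF h L(1) closed_cball _ Ks])
    then show "S \<le> ?f L + d" by simp
  qed
  have full: "?f L = ?\<mu> ?B"
  proof (rule ccontr)
    assume "?f L \<noteq> ?\<mu> ?B"
    then have lt: "?f L < ?\<mu> ?B" using fle[OF \<open>L \<in> \<C>\<close>] by simp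
    have big: "?\<mu> ?B \<le> ?\<mu> L" using \<open>L \<in> \<C>\<close> by (simp add: \<C>_def measure_cball_ball)
    obtain p q where pq: "p \<noteq> q" "side p q 0 \<le> 0" and inc: "?f L < ?f (polar p q L)"
      using polarization_increases[OF L(1) big lt] by blast
    have Lb: "L \<in> sets borel" using L(1) by (rule borel_compact)
    have sub: "polar p q L \<subseteq> cball 0 M" by (rule polar_subset_cball[OF pq L(3)])
    have "compact (polar p q L)"
      using closed_polar[of L p q] L(1) sub compact_imp_closed bounded_subset[OF bounded_cball sub]
      by (auto simp: compact_eq_bounded_closed)
    moreover have "?\<mu> (polar p q L) = ?\<mu> L" by (rule measure_polar[OF pq(1) Lb])
    moreover have "?\<mu> (nbhd r (polar p q L)) \<le> ?\<mu> (nbhd r L)"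
    proof -
      have "nbhd r L \<in> lmeasurable" using compact_imp_bounded[OF L(1)] by simp
      moreover have "polar p q (nbhd r L) \<in> lmeasurable"
        using emeasure_polar[OF pq(1), of "nbhd r L"] borel_polar[of "nbhd r L" p q] calculation
        by (auto simp: fmeasurable_def)
      ultimately have "?\<mu> (nbhd r (polar p q L)) \<le> ?\<mu> (polar p q (nbhd r L))"
        using nbhd_polar[OF pq(1)] by (intro measure_mono_fmeasurable) auto
      then show ?thesis using measure_polar[OF pq(1), of "nbhd r L"] by simp
    qed
    ultimately have "polar p q L \<in> \<C>" using \<open>L \<in> \<C>\<close> sub by (auto simp: \<C>_def)
    then show False using Smax SL inc by fastforce
  qed
  have "ball 0 R \<subseteq> L"
  proof (rule ccontr)
    assume "\<not> ball 0 R \<subseteq> L"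
    then have "ball 0 R - L \<noteq> {}" by auto
    moreover have "open (ball 0 R - L)" using L(1) compact_imp_closed by auto
    ultimately have "0 < ?\<mu> (ball 0 R - L)"
      by (intro open_pos_measure) (auto intro!: fmeasurable.Diff simp: L compact_imp_closed lmeasurable_compact)
    also have "\<dots> \<le> ?\<mu> (?B - L)" using L(1)
      by (intro measure_mono_fmeasurable) (auto intro!: fmeasurable.Diff simp: compact_imp_closed lmeasurable_compact)
    also have "?\<mu> (?B - L) = ?\<mu> ?B - ?f L"
      using measurable_measure_Diff[of ?B lebesgue "L \<inter> ?B"] L(1) by (auto simp: Diff_Int compact_imp_closed)
    finally show False using full by simp
  qed
  then have "ball 0 (R + r) \<subseteq> nbhd r L" using nbhd_mono[of "ball (0::'a) R" L r r] nbhd_ball[OF R r, of "0::'a"] by simp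
  then have "?\<mu> (ball 0 (R + r)) \<le> ?\<mu> (nbhd r L)"
    using compact_imp_bounded[OF L(1)] by (intro measure_mono_fmeasurable) auto
  also have "\<dots> \<le> ?\<mu> (nbhd r F)" using \<open>L \<in> \<C>\<close> by (simp add: \<C>_def)
  finally show ?thesis .
qed

section \<open>Convex sets with minimal dilation are balls\<close>

text \<open>The equality case. The sets of this locale attain equality in \<open>measure_nbhd_ge_ball\<close>. Since
polarization leads to sets that obey the same inequality, it cannot change the volume of the dilation
of \<open>K\<close> by less than \<open>r\<close>, and this rigidity forces every two outer normals of \<open>K\<close> to be placed as on a sphere.\<close>

locale extremal_body =
  fixes K :: "'a::euclidean_space set" and R r :: real
  assumes K: "compact K" and R: "0 < R" and r: "0 < r"
    and big: "measure lebesgue (ball (0::'a) R) \<le> measure lebesgue K"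
    and small: "measure lebesgue (nbhd r K) \<le> measure lebesgue (ball (0::'a) (R + r))"
begin

lemma K_facts: "closed K" "bounded K" "K \<in> sets borel" "K \<in> lmeasurable" "nbhd s K \<in> lmeasurable"
  using K by (auto simp: compact_imp_closed compact_imp_bounded borel_compact lmeasurable_compact)

text \<open>Dilating by \<open>r\<close> amounts to dilating by \<open>s\<close> and then by \<open>r - s\<close>; by the isoperimetric
inequality an excess of volume after the first step would persist after the second. The freedom to take \<open>s\<close> small is what makes the reflections below
separate the two boundary points under consideration.\<close>

lemma small_scale:
  assumes s: "0 < s" "s < r"
  shows "measure lebesgue (nbhd s K) \<le> measure lebesgue (ball (0::'a) (R + s))"
proof (rule ccontr)
  assume "\<not> ?thesis"
  then have lt: "measure lebesgue (ball (0::'a) (R + s)) < measure lebesgue (nbhd s K)" by simp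
  obtain R' where R': "0 \<le> R'" "measure lebesgue (ball (0::'a) R') = measure lebesgue (nbhd s K)"
    using ex_ball_measure[of "measure lebesgue (nbhd s K)"] by auto
  have less: "R + s < R'"
    using lt measure_ball_mono_iff[of R' "R + s" "0::'a" 0] R'(1) R s unfolding R'(2)[symmetric] by simp
  let ?C = "closure (nbhd s K)"
  have cC: "compact ?C" using bounded_nbhd[OF K_facts(2)] by (simp add: compact_closure)
  have "measure lebesgue (nbhd s K) \<le> measure lebesgue ?C"
    using K_facts(5) lmeasurable_compact[OF cC] closure_subset by (intro measure_mono_fmeasurable) auto
  then have "measure lebesgue (ball (0::'a) (R' + (r - s))) \<le> measure lebesgue (nbhd (r - s) ?C)"
    using R' less R s by (intro measure_nbhd_ge_ball[OF cC]) auto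
  also have "\<dots> \<le> measure lebesgue (nbhd r K)"
    unfolding nbhd_closure using nbhd_nbhd[of "r - s" s K] K_facts by (intro measure_mono_fmeasurable) auto
  also have "\<dots> \<le> measure lebesgue (ball (0::'a) (R + r))" by (rule small)
  finally have "R' + (r - s) \<le> R + r"
    using measure_ball_mono_iff[of "R' + (r - s)" "R + r" "0::'a" 0] R' R r s by simp
  then show False using less by simp
qed

lemma compact_polar_K:
  assumes "p \<noteq> q" shows "compact (polar p q K)"
proof -
  have "bounded (mirror p q ` K)" using K continuous_on_mirror[of K p q] compact_continuous_image compact_imp_bounded by blast
  moreover have "polar p q K \<subseteq> K \<union> mirror p q ` K"
    using assms by (auto simp: polar_def image_iff) (metis mirror_mirror)
  ultimately have "bounded (polar p q K)" using K_facts(2) by (meson bounded_Un bounded_subset)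
  then show ?thesis using closed_polar[OF K_facts(1)] by (simp add: compact_eq_bounded_closed)
qed

text \<open>The dilation of the polarized set is contained in the polarized dilation and both have the same
volume, so their difference has no interior. A point that lies in \<open>nbhd s K\<close> together with its
mirror image belongs to the polarized dilation on whichever side it lies.\<close>

lemma polar_dense:
  assumes pq: "p \<noteq> q" and s: "0 < s" "s < r" and x: "x \<in> nbhd s K" "mirror p q x \<in> nbhd s K"
  shows "x \<in> closure (nbhd s (polar p q K))"
proof (rule ccontr)
  let ?\<mu> = "measure lebesgue :: 'a set \<Rightarrow> real"
  let ?N = "nbhd s (polar p q K)"
  assume nx: "x \<notin> closure ?N"
  let ?U = "nbhd s K \<inter> mirror p q -` nbhd s K \<inter> - closure ?N"
  have "open (mirror p q -` nbhd s K)" by (intro open_vimage open_nbhd continuous_on_mirror)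
  then have oU: "open ?U" by (intro open_Int open_nbhd open_Compl closed_closure)
  have neU: "?U \<noteq> {}" using x nx by auto
  have mU: "?U \<in> lmeasurable" using oU K_facts(2) bounded_nbhd by (intro lmeasurable_open) (auto intro: bounded_subset)
  have mN: "?N \<in> lmeasurable" using compact_polar_K[OF pq] by (simp add: compact_imp_bounded)
  have mP: "polar p q (nbhd s K) \<in> lmeasurable"
    using emeasure_polar[OF pq, of "nbhd s K"] borel_polar[of "nbhd s K" p q] K_facts(5)[of s]
    by (auto simp: fmeasurable_def)
  have "?\<mu> ?N < ?\<mu> ?N + ?\<mu> ?U" using open_pos_measure[OF oU neU mU] by simp
  also have "\<dots> = ?\<mu> (?N \<union> ?U)"
  proof -
    have "?N \<inter> ?U = {}" using closure_subset[of ?N] by blast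
    then show ?thesis using mN mU by (intro measure_Union[symmetric]) (auto simp del: emeasure_completion simp: fmeasurable_def)
  qed
  also have "\<dots> \<le> ?\<mu> (polar p q (nbhd s K))"
  proof -
    have "?U \<subseteq> polar p q (nbhd s K)" by (auto simp: polar_def)
    then show ?thesis using nbhd_polar[OF pq, of s K] mN mU mP by (intro measure_mono_fmeasurable) auto
  qed
  also have "\<dots> = ?\<mu> (nbhd s K)" by (rule measure_polar[OF pq]) auto
  also have "\<dots> \<le> ?\<mu> (ball 0 (R + s))" by (rule small_scale[OF s])
  also have "\<dots> \<le> ?\<mu> ?N"
    using big measure_polar[OF pq K_facts(3)] by (intro measure_nbhd_ge_ball[OF compact_polar_K[OF pq] R s(1)]) simp
  finally show False by simp
qed

text \<open>The limit form of \<open>polar_dense\<close>: at points at distance exactly \<open>s\<close> it is applied with radii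
decreasing to \<open>s\<close>.\<close>

lemma polar_close:
  assumes pq: "p \<noteq> q" and s: "0 < s" "s < r"
    and ab: "a \<in> K" "dist a x = s" "b \<in> K" "dist b (mirror p q x) = s"
  shows "\<exists>y\<in>polar p q K. dist y x \<le> s"
proof -
  let ?P = "polar p q K"
  have near: "\<exists>y\<in>?P. dist x y < s + d" if d: "0 < d" for d
  proof -
    define s' where "s' = min (s + d/2) ((s + r)/2)"
    have s': "s < s'" "s' < r" "s' \<le> s + d/2" using s d by (simp_all add: s'_def min_less_iff_disj)
    have "x \<in> nbhd s' K" "mirror p q x \<in> nbhd s' K" unfolding mem_nbhd using ab s'(1) by metis+
    then have "x \<in> closure (nbhd s' ?P)" using s s' by (intro polar_dense[OF pq]) auto
    then obtain z where "z \<in> nbhd s' ?P" "dist z x < d/2" using d by (metis closure_approachable half_gt_zero)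
    then obtain y where "y \<in> ?P" "dist y z < s'" "dist z x < d/2" by (auto simp: mem_nbhd)
    then show ?thesis using s' dist_triangle[of y x z] by (intro bexI[of _ y]) (auto simp: dist_commute)
  qed
  then have ne: "?P \<noteq> {}" by (metis empty_iff zero_less_one)
  obtain y where y: "y \<in> ?P" "\<And>z. z \<in> ?P \<Longrightarrow> dist x y \<le> dist x z"
    using distance_attains_inf[OF closed_polar[OF K_facts(1)] ne, of x] by metis
  have "dist x y \<le> s"
  proof (rule field_le_epsilon)
    fix d :: real assume "0 < d"
    then show "dist x y \<le> s + d" using near[of d] y(2) by force
  qed
  then show ?thesis using y(1) by (auto simp: dist_commute)
qed

text \<open>A point moved outwards along a normal has its old position as unique nearest point of \<open>K\<close>.\<close>

lemma foot_unique:
  assumes n: "norm v = 1" "\<And>y. y \<in> K \<Longrightarrow> v \<bullet> y \<le> v \<bullet> x" and s: "0 < s"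
    and y: "y \<in> K" "dist y (x + s *\<^sub>R v) \<le> s"
  shows "y = x"
proof -
  have "(dist y (x + s *\<^sub>R v))\<^sup>2 = (norm (y - x))\<^sup>2 - 2 * s * (v \<bullet> (y - x)) + s\<^sup>2 * (v \<bullet> v)"
    unfolding dist_norm power2_norm_eq_inner
    by (simp add: inner_diff inner_add inner_commute algebra_simps power2_eq_square)
  also have "v \<bullet> v = 1" using n by (simp add: power2_norm_eq_inner[symmetric])
  finally have e: "(dist y (x + s *\<^sub>R v))\<^sup>2 = (norm (y - x))\<^sup>2 - 2 * s * (v \<bullet> (y - x)) + s\<^sup>2" by simp
  have "v \<bullet> (y - x) \<le> 0" using n(2)[OF y(1)] by (simp add: inner_diff)
  then have "0 \<le> - (2 * s * (v \<bullet> (y - x)))" using s by (simp add: mult_nonneg_nonpos)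
  moreover have "(dist y (x + s *\<^sub>R v))\<^sup>2 \<le> s\<^sup>2" using y(2) by (simp add: power_mono)
  ultimately have "(norm (y - x))\<^sup>2 \<le> 0" using e by linarith
  then show ?thesis by simp
qed

text \<open>On a sphere the difference of two unit normals is a multiple of the difference of their foot points.
To get this for \<open>K\<close>, push \<open>x1\<close> and \<open>x2\<close> outwards by a small \<open>s\<close> to \<open>p\<close> and \<open>q\<close>, and polarize with
respect to the mirror between \<open>p\<close> and \<open>q\<close>. The polarized set must still come within \<open>s\<close> of \<open>p\<close>,
on the disfavoured side. As \<open>x1\<close> and \<open>x2\<close> are the only points of \<open>K\<close> that close to \<open>p\<close> and
\<open>q\<close>, this is possible only if the mirror maps \<open>x1\<close> to \<open>x2\<close>. Then both \<open>p - q\<close> and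
\<open>x1 - x2\<close> are orthogonal to the mirror, and so is \<open>v1 - v2\<close>.\<close>

lemma normals_parallel:
  assumes x: "x1 \<in> K" "x2 \<in> K" "x1 \<noteq> x2"
    and v1: "norm v1 = 1" "\<And>y. y \<in> K \<Longrightarrow> v1 \<bullet> y \<le> v1 \<bullet> x1"
    and v2: "norm v2 = 1" "\<And>y. y \<in> K \<Longrightarrow> v2 \<bullet> y \<le> v2 \<bullet> x2"
  shows "\<exists>c. v1 - v2 = c *\<^sub>R (x1 - x2)"
proof -
  define s where "s = min r (dist x1 x2 / 2) / 2"
  have s: "0 < s" "s < r" "2 * s < dist x1 x2" using r x(3) by (auto simp: s_def min_def field_simps)
  define p q where "p = x1 + s *\<^sub>R v1" and "q = x2 + s *\<^sub>R v2"
  have d1: "dist x1 p = s" and d2: "dist x2 q = s" using v1 v2 s by (auto simp: p_def q_def dist_norm)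
  have pq: "p \<noteq> q" using d1 d2 s dist_triangle[of x1 x2 p] by (auto simp: dist_commute)
  have "s < dist x1 q" using d2 s dist_triangle[of x1 x2 q] by (simp add: dist_commute)
  then have s1: "0 < side p q x1" using d1 s by (simp add: side_dist power_strict_mono)
  have "s < dist x2 p" using d1 s dist_triangle[of x1 x2 p] by (simp add: dist_commute)
  then have s2: "side p q x2 < 0" using d2 s by (simp add: side_dist power_strict_mono)
  obtain y where y: "y \<in> polar p q K" "dist y p \<le> s"
    using polar_close[OF pq s(1,2) x(1) d1 x(2)] d2 by (auto simp: mirror_left[OF pq])
  have yK: "y = x1" if "y \<in> K" using foot_unique[OF v1 s(1) that] y(2) by (simp add: p_def)
  have myK: "mirror p q y = x2" if "mirror p q y \<in> K"
    using foot_unique[OF v2 s(1) that] y(2) dist_mirror_swap[OF pq, of y q]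
    by (simp add: q_def[symmetric] mirror_right[OF pq])
  have "\<not> side p q y \<le> 0 \<or> y \<notin> K" using yK s1 by auto
  moreover have "\<not> side p q y \<le> 0 \<or> mirror p q y \<notin> K" using myK s2 side_mirror[OF pq, of y] by auto
  ultimately have "y \<in> K" "mirror p q y \<in> K" using y(1) by (auto simp: polar_def)
  then have m: "mirror p q x1 = x2" using yK myK by simp
  define k where "k = 2 * side p q x1 / ((p - q) \<bullet> (p - q))"
  have k: "x1 - x2 = k *\<^sub>R (p - q)" unfolding m[symmetric] mirror_def k_def by simp
  then have "k \<noteq> 0" using x(3) by auto
  then have "p - q = (1 / k) *\<^sub>R (x1 - x2)" by (simp add: k)
  moreover have "s *\<^sub>R (v1 - v2) = (p - q) - (x1 - x2)" by (simp add: p_def q_def algebra_simps)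
  ultimately have "s *\<^sub>R (v1 - v2) = (1 / k - 1) *\<^sub>R (x1 - x2)" by (simp add: scaleR_left_diff_distrib)
  then have "(1 / s) *\<^sub>R (s *\<^sub>R (v1 - v2)) = (1 / s) *\<^sub>R ((1 / k - 1) *\<^sub>R (x1 - x2))" by (rule arg_cong)
  then have "v1 - v2 = ((1 / s) * (1 / k - 1)) *\<^sub>R (x1 - x2)" using s by simp
  then show ?thesis by blast
qed

end

lemma frontier_normal:
  fixes K :: "'a::euclidean_space set"
  assumes "convex K" "interior K \<noteq> {}" "x \<in> frontier K"
  obtains v where "norm v = 1" "\<And>y. y \<in> K \<Longrightarrow> v \<bullet> y \<le> v \<bullet> x"
proof -
  have "interior K \<inter> {x} = {}" using assms(3) by (auto simp: frontier_def)
  then obtain a b where ab: "a \<noteq> 0" "\<And>y. y \<in> interior K \<Longrightarrow> a \<bullet> y \<le> b" "b \<le> a \<bullet> x"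
    using separating_hyperplane_sets[OF convex_interior[OF assms(1)] convex_singleton assms(2), of x] by auto
  have "a \<bullet> y \<le> a \<bullet> x" if "y \<in> K" for y
  proof -
    have "closure (interior K) \<subseteq> {y. a \<bullet> y \<le> a \<bullet> x}"
      using ab by (intro closure_minimal closed_halfspace_le) force
    then show ?thesis using that convex_closure_interior[OF assms(1,2)] closure_subset by blast
  qed
  then have "(a /\<^sub>R norm a) \<bullet> y \<le> (a /\<^sub>R norm a) \<bullet> x" if "y \<in> K" for y
    using that by (simp add: mult_left_mono)
  then show ?thesis using ab(1) that[of "a /\<^sub>R norm a"] by simp
qed

text \<open>A farthest point from \<open>x0\<close> lies on the frontier, so \<open>K\<close> is contained in the closed ball; and the
open ball is connected, meets \<open>K\<close> and avoids its frontier, so it is contained in \<open>K\<close>.\<close>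

lemma compact_frontier_in_sphere:
  fixes K :: "'a::euclidean_space set"
  assumes K: "compact K" and x0: "x0 \<in> K" and fr: "frontier K \<subseteq> sphere x0 \<rho>" and \<rho>: "0 < \<rho>"
  shows "K = cball x0 \<rho>"
proof
  obtain y where y: "y \<in> K" "\<And>z. z \<in> K \<Longrightarrow> dist x0 z \<le> dist x0 y"
    using distance_attains_sup[of K x0] K x0 by auto
  have "y \<in> frontier K"
  proof (rule ccontr)
    assume "y \<notin> frontier K"
    then have "y \<in> interior K" using y(1) closure_subset by (auto simp: frontier_def)
    then obtain e where e: "0 < e" "cball y e \<subseteq> K" by (meson mem_interior_cball)
    show False
    proof (cases "y = x0")
      case True
      obtain u :: 'a where u: "norm u = e" using vector_choose_size[of e] e by auto
      have "y + u \<in> K" using e u by (auto simp: dist_norm)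
      then show False using y(2)[of "y + u"] True u e by (simp add: dist_norm)
    next
      case False
      let ?t = "e / norm (y - x0)"
      let ?z = "y + ?t *\<^sub>R (y - x0)"
      have "dist y ?z = e" using False e by (simp add: dist_norm)
      then have zK: "?z \<in> K" using e by auto
      have "?z - x0 = (1 + ?t) *\<^sub>R (y - x0)" by (simp add: algebra_simps)
      then have "norm (?z - x0) = (1 + ?t) * norm (y - x0)" using e by (simp only: norm_scaleR) simp
      also have "\<dots> = norm (y - x0) + e" using False by (simp add: distrib_right)
      finally have "dist x0 ?z = dist x0 y + e" by (simp only: dist_norm norm_minus_commute[of x0])
      then show False using y(2)[OF zK] e by simp
    qed
  qed
  then have "dist x0 y = \<rho>" using fr by auto
  then show "K \<subseteq> cball x0 \<rho>" using y(2) by auto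
  show "cball x0 \<rho> \<subseteq> K"
  proof -
    have "ball x0 \<rho> \<subseteq> K"
    proof (rule ccontr)
      assume "\<not> ball x0 \<rho> \<subseteq> K"
      then have "ball x0 \<rho> \<inter> frontier K \<noteq> {}"
        using x0 \<rho> centre_in_ball[of x0 \<rho>] by (intro connected_Int_frontier) blast+
      then show False using fr by auto
    qed
    then have "closure (ball x0 \<rho>) \<subseteq> K" using K by (intro closure_minimal compact_imp_closed)
    then show ?thesis using \<rho> by simp
  qed
qed

text \<open>Opposite points \<open>x1\<close>, \<open>x2\<close> with normals \<open>e\<close>, \<open>- e\<close> fix a centre \<open>x0\<close> and a radius \<open>\<rho>\<close>. For
a third frontier point with normal \<open>v\<close>, comparison with \<open>x1\<close> and \<open>x2\<close> by \<open>normals_parallel\<close>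
expresses \<open>v\<close> in two ways, which forces \<open>v\<close> to be a multiple of \<open>x3 - x0\<close> with the factor
\<open>1 / \<rho>\<close>.\<close>

theorem convex_minimal_dilation_is_ball:
  fixes K :: "'a::euclidean_space set"
  assumes K: "compact K" and cv: "convex K" and R: "0 < R" and r: "0 < r"
    and big: "measure lebesgue (ball (0::'a) R) \<le> measure lebesgue K"
    and small: "measure lebesgue (nbhd r K) \<le> measure lebesgue (ball (0::'a) (R + r))"
  shows "\<exists>x0. K = cball x0 R"
proof -
  interpret extremal_body K R r using K R r big small by unfold_locales
  have "0 < measure lebesgue (ball (0::'a) R)" using R by (simp add: content_ball_pos)
  then have pos: "0 < measure lebesgue K" using big by linarith
  have int: "interior K \<noteq> {}"
  proof
    assume "interior K = {}"
    then have "negligible K" using cv negligible_convex_interior by blast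
    then show False using pos by (simp add: negligible_imp_measure0)
  qed
  then have ne: "K \<noteq> {}" by auto
  obtain e :: 'a where e: "norm e = 1" using vector_choose_size[of 1] by auto
  have co: "continuous_on K (\<lambda>y. e \<bullet> y)" by (intro continuous_intros)
  obtain x1 where x1: "x1 \<in> K" "\<And>y. y \<in> K \<Longrightarrow> e \<bullet> y \<le> e \<bullet> x1"
    using continuous_attains_sup[OF K ne co] by auto
  obtain x2 where x2: "x2 \<in> K" "\<And>y. y \<in> K \<Longrightarrow> e \<bullet> x2 \<le> e \<bullet> y"
    using continuous_attains_inf[OF K ne co] by auto
  have ee: "e \<bullet> e = 1" using e by (simp add: power2_norm_eq_inner[symmetric])
  have gap: "e \<bullet> x2 < e \<bullet> x1"
  proof -
    obtain z d where z: "0 < d" "cball z d \<subseteq> K" using int by (meson all_not_in_conv mem_interior_cball)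
    have "z \<in> K" "z + d *\<^sub>R e \<in> K" using z e by (auto simp: dist_norm subset_iff)
    then have "e \<bullet> x2 \<le> e \<bullet> z" "e \<bullet> (z + d *\<^sub>R e) \<le> e \<bullet> x1" using x1 x2 by auto
    then show ?thesis using z(1) ee by (simp add: inner_add)
  qed
  then have "x1 \<noteq> x2" by auto
  then obtain c where "e - (- e) = c *\<^sub>R (x1 - x2)"
    using normals_parallel[of x1 x2 e "- e"] x1 x2 e by auto
  then have c2: "2 *\<^sub>R e = c *\<^sub>R (x1 - x2)" by (simp add: scaleR_2)
  have "2 = c * (e \<bullet> (x1 - x2))"
    using arg_cong[OF c2, of "\<lambda>y. e \<bullet> y"] ee by simp
  then have cpos: "0 < c" using gap by (metis diff_gt_0_iff_gt inner_diff_right zero_less_mult_pos2 zero_less_numeral)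
  define x0 where "x0 = (1/2) *\<^sub>R (x1 + x2)"
  define \<rho> where "\<rho> = 1 / c"
  have \<rho>: "0 < \<rho>" using cpos by (simp add: \<rho>_def)
  have "(1 / c) *\<^sub>R (2 *\<^sub>R e) = (1 / c) *\<^sub>R (c *\<^sub>R (x1 - x2))" using c2 by simp
  then have dx: "x1 - x2 = (2 * \<rho>) *\<^sub>R e" using cpos by (simp add: \<rho>_def)
  have X1: "x1 = x0 + \<rho> *\<^sub>R e" 
  proof -
    have "x1 = x0 + (1/2) *\<^sub>R (x1 - x2)" by (simp add: x0_def algebra_simps scaleR_left_distrib[symmetric])
    then show ?thesis by (simp add: dx)
  qed
  have X2: "x2 = x0 - \<rho> *\<^sub>R e"
  proof -
    have "x2 = x0 - (1/2) *\<^sub>R (x1 - x2)" by (simp add: x0_def algebra_simps scaleR_left_distrib[symmetric])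
    then show ?thesis by (simp add: dx)
  qed
  have "x0 \<in> K" unfolding x0_def using convexD[OF cv x1(1) x2(1), of "1/2" "1/2"] by (simp add: scaleR_right_distrib)
  have "frontier K \<subseteq> sphere x0 \<rho>"
  proof
    fix x3 assume fr: "x3 \<in> frontier K"
    then have x3: "x3 \<in> K" using K compact_imp_closed frontier_subset_closed by blast
    obtain v where v: "norm v = 1" "\<And>y. y \<in> K \<Longrightarrow> v \<bullet> y \<le> v \<bullet> x3"
      using frontier_normal[OF cv int fr] by blast
    have vv: "v \<bullet> v = 1" using v by (simp add: power2_norm_eq_inner[symmetric])
    show "x3 \<in> sphere x0 \<rho>"
    proof (cases "x3 = x1 \<or> x3 = x2")
      case True
      then show ?thesis using X1 X2 e \<rho> by (auto simp: dist_norm)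
    next
      case False
      obtain a where a: "v - e = a *\<^sub>R (x3 - x1)"
        using normals_parallel[of x3 x1 v e] x3 x1 v e False by auto
      obtain b where b: "v - (- e) = b *\<^sub>R (x3 - x2)"
        using normals_parallel[of x3 x2 v "- e"] x3 x2 v e False by auto
      have va: "v = a *\<^sub>R (x3 - x0) + (1 - a * \<rho>) *\<^sub>R e" using a by (simp add: X1 algebra_simps)
      have vb: "v = b *\<^sub>R (x3 - x0) - (1 - b * \<rho>) *\<^sub>R e" using b by (simp add: X2 algebra_simps)
      have lin: "(a - b) *\<^sub>R (x3 - x0) = (a * \<rho> + b * \<rho> - 2) *\<^sub>R e"
        using va vb by (simp add: algebra_simps scaleR_2)
      show ?thesis
      proof (cases "a = b")
        case True
        then have "a * \<rho> + b * \<rho> - 2 = 0" using lin e by auto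
        then have "a * \<rho> = 1" using True by (simp add: mult.commute)
        then have "v = a *\<^sub>R (x3 - x0)" using va by simp
        then have "1 = \<bar>a\<bar> * norm (x3 - x0)" using v(1) by simp
        moreover have "a = c" using \<open>a * \<rho> = 1\<close> cpos by (simp add: \<rho>_def field_simps)
        ultimately have "norm (x3 - x0) = \<rho>" using cpos by (simp add: \<rho>_def field_simps)
        then show ?thesis by (simp add: dist_norm norm_minus_commute)
      next
        case False
        \<comment> \<open>Degenerate case: the third point lies on the axis through \<open>x1\<close> and \<open>x2\<close>. Its normal is
          then parallel to the axis, so the point is an end point of the chord.\<close>
        define t where "t = (a * \<rho> + b * \<rho> - 2) / (a - b)"
        have "(1 / (a - b)) *\<^sub>R ((a - b) *\<^sub>R (x3 - x0)) = (1 / (a - b)) *\<^sub>R ((a * \<rho> + b * \<rho> - 2) *\<^sub>R e)"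
          using lin by simp
        then have xt: "x3 - x0 = t *\<^sub>R e" using False by (simp add: t_def)
        define w where "w = a * t + (1 - a * \<rho>)"
        have vw: "v = w *\<^sub>R e" using va unfolding xt w_def by (simp add: algebra_simps)
        have X3: "x3 = x0 + t *\<^sub>R e" using xt by (simp add: algebra_simps)
        have w1: "\<bar>w\<bar> = 1" using v(1) vw e by simp
        have "e \<bullet> x3 \<le> e \<bullet> x1" "e \<bullet> x2 \<le> e \<bullet> x3" using x1 x2 x3 by auto
        then have t1: "t \<le> \<rho>" "- \<rho> \<le> t" by (auto simp: X1 X2 X3 inner_add inner_diff ee)
        have "w * \<rho> \<le> w * t" "- (w * \<rho>) \<le> w * t"
          using v(2)[OF x1(1)] v(2)[OF x2(1)] by (auto simp: vw X1 X2 X3 inner_add inner_diff ee mult.commute)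
        then have "t = \<rho> \<or> t = - \<rho>" using w1 t1 by (auto simp: abs_if split: if_splits)
        then show ?thesis using \<rho> e by (auto simp: X3 dist_norm)
      qed
    qed
  qed
  then have KB: "K = cball x0 \<rho>" by (rule compact_frontier_in_sphere[OF K \<open>x0 \<in> K\<close> _ \<rho>])
  have "R \<le> \<rho>" using big measure_ball_mono_iff[of R \<rho> 0 x0] R \<rho> by (simp add: KB content_cball_conv_ball)
  moreover have "\<rho> \<le> R"
    using small measure_ball_mono_iff[of "\<rho> + r" "R + r" x0 0] R \<rho> r by (simp add: KB nbhd_cball)
  ultimately show ?thesis using KB by auto
qed

section \<open>Stability of the ball\<close>

text \<open>A segment of length \<open>D\<close> in \<open>E\<close> carries about \<open>D / (2 * r)\<close> disjoint balls of radius \<open>r\<close>, all of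
them contained in the dilation. So a bound on the volume of the dilation gives compactness of convex
sets up to translations.\<close>

lemma convex_diameter_bound:
  fixes E :: "'a::euclidean_space set"
  assumes cv: "convex E" and r: "0 < r" and fin: "nbhd r E \<in> lmeasurable"
    and x: "x \<in> E" and y: "y \<in> E"
  shows "dist x y \<le> 2 * r * (measure lebesgue (nbhd r E) / measure lebesgue (ball (0::'a) r) + 1)"
proof (cases "x = y")
  case True
  then show ?thesis using r by (simp add: add_nonneg_nonneg)
next
  case False
  define D where "D = dist x y"
  have D: "0 < D" using False by (simp add: D_def)
  define N where "N = nat \<lfloor>D / (2 * r)\<rfloor>"
  have N1: "real N \<le> D / (2 * r)" "D / (2 * r) < real N + 1" using D r by (auto simp: N_def)
  define c where "c i = x + (2 * r * real i / D) *\<^sub>R (y - x)" for i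
  have cE: "c i \<in> E" if "i < N" for i
  proof -
    have "2 * r * real i \<le> 2 * r * real N" using that r by simp
    also have "\<dots> \<le> D" using N1(1) r by (simp add: field_simps)
    finally have "2 * r * real i / D \<le> 1" "0 \<le> 2 * r * real i / D" using D r by auto
    then have "(1 - 2 * r * real i / D) *\<^sub>R x + (2 * r * real i / D) *\<^sub>R y \<in> E"
      using cv x y by (intro convexD) auto
    then show ?thesis by (simp add: c_def algebra_simps)
  qed
  have cdist: "2 * r \<le> dist (c i) (c j)" if "i \<noteq> j" for i j
  proof -
    have "c i - c j = (2 * r * (real i - real j) / D) *\<^sub>R (y - x)"
      by (simp add: c_def algebra_simps diff_divide_distrib)
    then have "dist (c i) (c j) = 2 * r * \<bar>real i - real j\<bar>"
      using D r by (simp add: dist_norm D_def norm_minus_commute abs_mult)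
    moreover have "1 \<le> \<bar>real i - real j\<bar>" using that by linarith
    ultimately show ?thesis using r by simp
  qed
  have disj: "disjoint_family_on (\<lambda>i. ball (c i) r) {..<N}"
    unfolding disjoint_family_on_def
  proof (intro ballI impI)
    fix i j :: nat assume "i \<noteq> j"
    show "ball (c i) r \<inter> ball (c j) r = {}"
    proof (rule ccontr)
      assume "ball (c i) r \<inter> ball (c j) r \<noteq> {}"
      then obtain z where "dist (c i) z < r" "dist (c j) z < r" by auto
      then show False using cdist[OF \<open>i \<noteq> j\<close>] dist_triangle2[of "c i" "c j" z] by linarith
    qed
  qed
  have "real N * measure lebesgue (ball (0::'a) r) = (\<Sum>i<N. measure lebesgue (ball (c i) r))"
    using r by (simp add: content_ball)
  also have "\<dots> = measure lebesgue (\<Union>i<N. ball (c i) r)"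
    using disj by (intro measure_finite_Union[symmetric]) (use emeasure_lborel_ball_finite in \<open>auto simp: less_top\<close>)
  also have "\<dots> \<le> measure lebesgue (nbhd r E)"
    using cE fin by (intro measure_mono_fmeasurable) (auto simp: nbhd_def)
  finally have "real N \<le> measure lebesgue (nbhd r E) / measure lebesgue (ball (0::'a) r)"
    using r by (simp add: content_ball_pos field_simps)
  then have "D / (2 * r) \<le> measure lebesgue (nbhd r E) / measure lebesgue (ball (0::'a) r) + 1"
    using N1(2) by linarith
  then show ?thesis using r unfolding D_def by (simp add: pos_divide_le_eq mult.commute)
qed

text \<open>Compactness turns uniqueness into stability: a sequence of counterexamples with \<open>d\<close> tending to \<open>0\<close>
has, after translation, a Hausdorff limit, and by semicontinuity the limit has minimal dilation, so
that it is a ball.\<close>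

theorem ball_stability:
  fixes R r e :: real
  assumes R: "0 < R" and r: "0 < r" and e: "0 < e"
  shows "\<exists>d>0. \<forall>F::'a::euclidean_space set. convex F \<longrightarrow> F \<noteq> {} \<longrightarrow> F \<in> lmeasurable \<longrightarrow> nbhd r F \<in> lmeasurable \<longrightarrow>
     measure lebesgue (ball (0::'a) R) \<le> measure lebesgue F \<longrightarrow>
     measure lebesgue (nbhd r F) \<le> measure lebesgue (ball (0::'a) (R + r)) + d \<longrightarrow>
     (\<exists>t. (+) t ` F \<subseteq> nbhd e (ball 0 R) \<and> ball 0 R \<subseteq> nbhd e ((+) t ` F))"
proof (rule ccontr)
  let ?\<mu> = "measure lebesgue :: 'a set \<Rightarrow> real"
  let ?good = "\<lambda>F::'a set. \<exists>t. (+) t ` F \<subseteq> nbhd e (ball 0 R) \<and> ball 0 R \<subseteq> nbhd e ((+) t ` F)"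
  let ?P = "\<lambda>F::'a set. convex F \<and> F \<noteq> {} \<and> F \<in> lmeasurable \<and> nbhd r F \<in> lmeasurable \<and> ?\<mu> (ball 0 R) \<le> ?\<mu> F"
  assume "\<not> ?thesis"
  then have "\<exists>F. ?P F \<and> ?\<mu> (nbhd r F) \<le> ?\<mu> (ball 0 (R + r)) + 1 / real (Suc i) \<and> \<not> ?good F" for i
    by (metis divide_pos_pos of_nat_0_less_iff zero_less_Suc zero_less_one)
  then obtain F where F: "\<And>i. ?P (F i)" "\<And>i. ?\<mu> (nbhd r (F i)) \<le> ?\<mu> (ball 0 (R + r)) + 1 / real (Suc i)"
      "\<And>i. \<not> ?good (F i)" by metis
  have "\<exists>z. z \<in> F i" for i using F(1)[of i] by blast
  then obtain a where a: "\<And>i. a i \<in> F i" by metis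
  define G where "G i = closure ((+) (- a i) ` F i)" for i
  define M where "M = 2 * r * ((?\<mu> (ball 0 (R + r)) + 1) / ?\<mu> (ball 0 r) + 1)"
  have nb: "nbhd s (G i) = (+) (- a i) ` nbhd s (F i)" for s i
    unfolding G_def nbhd_closure by (rule nbhd_translation)
  have Gsub: "G i \<subseteq> cball 0 M" for i
  proof -
    have "norm (z - a i) \<le> M" if z: "z \<in> F i" for z
    proof -
      have "dist z (a i) \<le> 2 * r * (?\<mu> (nbhd r (F i)) / ?\<mu> (ball 0 r) + 1)"
        using F(1) r z a by (intro convex_diameter_bound) auto
      also have "?\<mu> (nbhd r (F i)) \<le> ?\<mu> (ball 0 (R + r)) + 1"
        using F(2)[of i] by (rule order_trans) simp
      then have "2 * r * (?\<mu> (nbhd r (F i)) / ?\<mu> (ball 0 r) + 1) \<le> M"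
        unfolding M_def using r by (intro mult_left_mono add_right_mono divide_right_mono) auto
      finally show ?thesis by (simp add: dist_norm)
    qed
    then have "(+) (- a i) ` F i \<subseteq> cball 0 M" by auto
    then show ?thesis unfolding G_def by (intro closure_minimal) auto
  qed
  have Gne: "G i \<noteq> {}" for i using F(1) by (simp add: G_def)
  have Gcv: "convex (G i)" for i using F(1) by (simp add: G_def convex_closure convex_translation)
  have GR: "?\<mu> (ball 0 R) \<le> ?\<mu> (G i)" for i
  proof -
    have "?\<mu> (ball 0 R) \<le> ?\<mu> ((+) (- a i) ` F i)" using F(1) by (simp only: measure_translation)
    also have "\<dots> \<le> ?\<mu> (G i)"
    proof (rule measure_mono_fmeasurable)
      show "(+) (- a i) ` F i \<subseteq> G i" unfolding G_def by (rule closure_subset)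
      show "(+) (- a i) ` F i \<in> sets lebesgue" using measurable_translation[of "F i" "- a i"] F(1) by (auto dest: fmeasurableD)
      show "G i \<in> lmeasurable" using Gsub[of i] by (intro lmeasurable_compact) (auto simp: G_def compact_eq_bounded_closed intro: bounded_subset)
    qed
    finally show ?thesis .
  qed
  obtain L \<phi> where \<phi>: "strict_mono (\<phi> :: nat \<Rightarrow> nat)" and L: "compact L" "L \<noteq> {}" "L \<subseteq> cball 0 M"
    and h: "hconv (G \<circ> \<phi>) L"
    using blaschke_selection[of G M, OF Gne Gsub] by blast
  have Gm: "(G \<circ> \<phi>) i \<in> sets lebesgue" for i by (simp add: G_def)
  have "convex L" by (rule hconv_convex[OF h _ compact_imp_closed[OF L(1)] L(2)]) (simp add: Gcv)
  moreover have "?\<mu> (ball 0 R) \<le> ?\<mu> (L \<inter> UNIV)"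
    by (rule measure_usc_hconv[OF h L(1) closed_UNIV _ Gm]) (use GR in auto)
  moreover have "?\<mu> (nbhd r L) \<le> ?\<mu> (ball 0 (R + r))"
  proof (rule measure_nbhd_lsc_hconv[OF h compact_imp_bounded[OF L(1)]])
    fix d :: real assume d: "0 < d"
    obtain N where N: "1 / real (Suc N) < d" using nat_approx_posE[OF d] by auto
    show "\<forall>\<^sub>F i in sequentially. ?\<mu> (nbhd r ((G \<circ> \<phi>) i)) \<le> ?\<mu> (ball 0 (R + r)) + d"
    proof (rule eventually_sequentiallyI)
      fix i assume "N \<le> i"
      then have "N \<le> \<phi> i" using strict_mono_imp_increasing[OF \<phi>, of i] by simp
      then have "1 / real (Suc (\<phi> i)) \<le> 1 / real (Suc N)" by (simp add: frac_le)
      moreover have "?\<mu> (nbhd r ((G \<circ> \<phi>) i)) = ?\<mu> (nbhd r (F (\<phi> i)))" by (simp only: comp_def nb measure_translation)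
      ultimately show "?\<mu> (nbhd r ((G \<circ> \<phi>) i)) \<le> ?\<mu> (ball 0 (R + r)) + d" using F(2)[of "\<phi> i"] N by linarith
    qed
  qed
  ultimately obtain x0 where LB: "L = cball x0 R"
    using convex_minimal_dilation_is_ball[OF L(1) _ R r] by auto
  obtain i where i: "L \<subseteq> nbhd e (G (\<phi> i))" "G (\<phi> i) \<subseteq> nbhd e L"
    using eventually_happens'[OF sequentially_bot hconvD[OF h e]] by auto
  let ?t = "- x0 - a (\<phi> i)"
  have tr: "(+) ?t ` F (\<phi> i) = (+) (- x0) ` (+) (- a (\<phi> i)) ` F (\<phi> i)" by (simp add: image_image algebra_simps)
  have bt: "(+) (- x0) ` ball x0 R = ball 0 R" by (simp only: image_add_ball) simp
  have "(+) (- a (\<phi> i)) ` F (\<phi> i) \<subseteq> nbhd e (cball x0 R)" using i(2) closure_subset unfolding G_def LB by blast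
  also have "nbhd e (cball x0 R) = nbhd e (ball x0 R)" using nbhd_closure[of e "ball x0 R"] R by simp
  finally have "(+) ?t ` F (\<phi> i) \<subseteq> (+) (- x0) ` nbhd e (ball x0 R)" unfolding tr by (rule image_mono)
  then have 1: "(+) ?t ` F (\<phi> i) \<subseteq> nbhd e (ball 0 R)" by (simp only: nbhd_translation[symmetric] bt)
  have "ball x0 R \<subseteq> nbhd e ((+) (- a (\<phi> i)) ` F (\<phi> i))"
    using i(1) ball_subset_cball unfolding G_def LB nbhd_closure by blast
  then have "(+) (- x0) ` ball x0 R \<subseteq> (+) (- x0) ` nbhd e ((+) (- a (\<phi> i)) ` F (\<phi> i))" by (rule image_mono)
  then have 2: "ball 0 R \<subseteq> nbhd e ((+) ?t ` F (\<phi> i))" by (simp only: nbhd_translation[symmetric] bt tr)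
  show False using F(3)[of "\<phi> i"] 1 2 by blast
qed

section \<open>Density and essential boundary of convex sets\<close>

lemma has_density_cong_null:
  assumes "sym_diff E F \<in> null_sets lebesgue" "E \<in> sets lebesgue"
  shows "has_density E x d \<longleftrightarrow> has_density F x (d::real)"
proof -
  have "measure lebesgue (E \<inter> ball x \<rho>) = measure lebesgue (F \<inter> ball x \<rho>)" for \<rho>
  proof (rule measure_negligible_symdiff[symmetric])
    show "negligible (sym_diff (E \<inter> ball x \<rho>) (F \<inter> ball x \<rho>))"
      using assms(1) unfolding negligible_iff_null_sets[symmetric] by (rule negligible_subset) auto
    show "E \<inter> ball x \<rho> \<in> lmeasurable"
      using assms by (intro bounded_set_imp_lmeasurable) (auto intro: bounded_subset[OF bounded_ball])
  qed
  then show ?thesis by (simp add: has_density_def)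
qed

lemma has_density_interior:
  fixes E :: "'a::euclidean_space set"
  assumes "x \<in> interior E" shows "has_density E x 1"
proof -
  obtain e where e: "0 < e" "ball x e \<subseteq> E" using assms by (meson mem_interior)
  have "\<forall>\<^sub>F \<rho> in at_right 0. measure lebesgue (E \<inter> ball x \<rho>) / measure lebesgue (ball x \<rho>) = 1"
    using eventually_at_right_less[of 0] eventually_at_right_real[OF e(1)]
  proof eventually_elim
    case (elim \<rho>)
    then have "E \<inter> ball x \<rho> = ball x \<rho>" using e(2) subset_ball[of \<rho> e x] by auto
    then show ?case using elim by (simp add: content_ball_pos[THEN less_imp_neq, symmetric])
  qed
  then show ?thesis unfolding has_density_def by (rule tendsto_eventually)
qed

lemma has_density_exterior:
  fixes E :: "'a::euclidean_space set"
  assumes "x \<notin> closure E" shows "has_density E x 0"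
proof -
  obtain e where e: "0 < e" "ball x e \<subseteq> - closure E" using assms by (metis ComplI open_Compl closed_closure openE)
  have "\<forall>\<^sub>F \<rho> in at_right 0. measure lebesgue (E \<inter> ball x \<rho>) / measure lebesgue (ball x \<rho>) = 0"
    using eventually_at_right_real[OF e(1)]
  proof eventually_elim
    case (elim \<rho>)
    then have "E \<inter> ball x \<rho> = {}" using e(2) subset_ball[of \<rho> e x] closure_subset[of E] by auto
    then show ?case by simp
  qed
  then show ?thesis unfolding has_density_def by (rule tendsto_eventually)
qed

text \<open>A hyperplane separates \<open>x\<close> from \<open>E\<close>, so the point reflection in \<open>x\<close> maps the part of \<open>E\<close> in
the ball to a disjoint part of equal volume.\<close>

lemma half_ball_bound:
  fixes E :: "'a::euclidean_space set"
  assumes E: "open E" "convex E" "x \<notin> E"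
  shows "2 * measure lebesgue (E \<inter> ball x \<rho>) \<le> measure lebesgue (ball x \<rho>)"
proof (cases "E = {}")
  case False
  obtain a b where ab: "a \<noteq> 0" "\<And>y. y \<in> E \<Longrightarrow> a \<bullet> y \<le> b" "b \<le> a \<bullet> x"
    using separating_hyperplane_sets[OF E(2) convex_singleton False, of x] E(3) by auto
  let ?f = "\<lambda>y. - y + 2 *\<^sub>R x"
  let ?A = "E \<inter> ball x \<rho>"
  have lt: "a \<bullet> y < a \<bullet> x" if y: "y \<in> E" for y
  proof -
    obtain e where e: "0 < e" "cball y e \<subseteq> E" using y E(1) by (meson open_contains_cball)
    have "y + (e / norm a) *\<^sub>R a \<in> E" using e ab(1) by (auto simp: subset_iff dist_norm)
    then have "a \<bullet> (y + (e / norm a) *\<^sub>R a) \<le> b" using ab by auto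
    moreover have "0 < (e / norm a) * (a \<bullet> a)" using e ab(1) by simp
    ultimately show ?thesis using ab(3) by (simp add: inner_add_right)
  qed
  have mA: "?A \<in> lmeasurable" using E by (intro lmeasurable_open) (auto intro: bounded_subset[OF bounded_ball])
  have img: "?f ` ?A = (\<lambda>y. (- 1) *\<^sub>R y + 2 *\<^sub>R x) ` ?A" by simp
  have mf: "measure lebesgue (?f ` ?A) = measure lebesgue ?A"
    unfolding img using measure_lebesgue_affine[of "- 1" "2 *\<^sub>R x" ?A] by simp
  have vim: "?f ` ?A = ?f -` ?A" 
  proof (intro set_eqI iffI)
    fix z assume "z \<in> ?f -` ?A"
    then have "?f (?f z) \<in> ?f ` ?A" by (intro imageI) simp
    then show "z \<in> ?f ` ?A" by simp
  qed auto
  have oA: "open ?A" using E by auto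
  have of: "open (?f ` ?A)" unfolding vim by (intro open_vimage[OF oA] continuous_intros)
  have sub: "?f ` ?A \<subseteq> ball x \<rho>"
  proof -
    have "dist x (?f y) = dist x y" for y
    proof -
      have "x - ?f y = y - x" by (simp add: scaleR_2)
      then show ?thesis by (simp only: dist_norm norm_minus_commute[of x y])
    qed
    then show ?thesis by auto
  qed
  have mfA: "?f ` ?A \<in> lmeasurable" using of sub by (intro lmeasurable_open) (auto intro: bounded_subset[OF bounded_ball])
  have "?A \<inter> ?f ` ?A = {}"
  proof (rule ccontr)
    assume "?A \<inter> ?f ` ?A \<noteq> {}"
    then obtain y where "y \<in> E" "?f y \<in> E" by auto
    then show False using lt[of y] lt[of "?f y"] by (simp add: inner_diff_right)
  qed
  then have "2 * measure lebesgue ?A = measure lebesgue (?A \<union> ?f ` ?A)"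
    using mA mfA mf by (subst measure_Union) (auto simp del: emeasure_completion simp: fmeasurable_def)
  also have "\<dots> \<le> measure lebesgue (ball x \<rho>)" using mA mfA sub by (intro measure_mono_fmeasurable) auto
  finally show ?thesis .
qed simp

lemma not_density_one_outside:
  fixes E :: "'a::euclidean_space set"
  assumes "open E" "convex E" "x \<notin> E" shows "\<not> has_density E x 1"
proof
  assume "has_density E x 1"
  then have lim: "((\<lambda>\<rho>. measure lebesgue (E \<inter> ball x \<rho>) / measure lebesgue (ball x \<rho>)) \<longlongrightarrow> 1) (at_right 0)"
    by (simp add: has_density_def)
  have "\<forall>\<^sub>F \<rho> in at_right 0. measure lebesgue (E \<inter> ball x \<rho>) / measure lebesgue (ball x \<rho>) \<le> 1/2"
    using eventually_at_right_less[of 0]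
  proof eventually_elim
    case (elim \<rho>)
    then have "0 < measure lebesgue (ball x \<rho>)" by (simp add: content_ball_pos)
    then show ?case using half_ball_bound[OF assms, of \<rho>] by (simp add: field_simps)
  qed
  then have "(1::real) \<le> 1/2" by (rule tendsto_upperbound[OF lim]) simp
  then show False by simp
qed

text \<open>Shrinking a ball contained in \<open>E\<close> towards \<open>x\<close> keeps it in \<open>E\<close>; so \<open>E\<close> fills a fixed fraction of
every small ball around \<open>x\<close>.\<close>

lemma not_density_zero_closure:
  fixes E :: "'a::euclidean_space set"
  assumes E: "open E" "convex E" "E \<noteq> {}" "x \<in> closure E" shows "\<not> has_density E x 0"
proof
  assume "has_density E x 0"
  then have lim: "((\<lambda>\<rho>. measure lebesgue (E \<inter> ball x \<rho>) / measure lebesgue (ball x \<rho>)) \<longlongrightarrow> 0) (at_right 0)"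
    by (simp add: has_density_def)
  obtain y e where y: "0 < e" "ball y e \<subseteq> E" using E by (meson all_not_in_conv openE)
  define D where "D = dist y x + e"
  have D: "0 < D" using y by (simp add: D_def add_nonneg_pos)
  let ?q = "(e / D) ^ DIM('a)"
  have q: "0 < ?q" using y D by simp
  have "\<forall>\<^sub>F \<rho> in at_right 0. ?q \<le> measure lebesgue (E \<inter> ball x \<rho>) / measure lebesgue (ball x \<rho>)"
    using eventually_at_right_less[of 0] eventually_at_right_real[OF D]
  proof eventually_elim
    case (elim \<rho>)
    define t where "t = \<rho> / D"
    have t: "0 < t" "t \<le> 1" "t * D = \<rho>" using elim D by (auto simp: t_def)
    let ?c = "x + t *\<^sub>R (y - x)"
    have "ball ?c (t * e) \<subseteq> E \<inter> ball x \<rho>"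
    proof
      fix z assume z: "z \<in> ball ?c (t * e)"
      define w where "w = x + (1 / t) *\<^sub>R (z - x)"
      have zw: "z = x - t *\<^sub>R (x - w)" using t by (simp add: w_def)
      have "w - y = (1 / t) *\<^sub>R (z - ?c)" using t by (simp add: w_def algebra_simps)
      then have "norm (w - y) = norm (z - ?c) / t" using t by simp
      moreover have "norm (z - ?c) < t * e" using z by (simp add: dist_norm norm_minus_commute)
      ultimately have "norm (w - y) < e" using t by (simp only: pos_divide_less_eq mult.commute)
      then have "w \<in> E" using y by (auto simp: dist_norm norm_minus_commute)
      then have "z \<in> interior E"
        unfolding zw using E t by (intro mem_interior_closure_convex_shrink) (auto simp: interior_open)
      then have "z \<in> E" using interior_subset by auto
      moreover have "dist x z < \<rho>"
      proof -
        have "dist x z \<le> dist x ?c + dist ?c z" by (rule dist_triangle)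
        also have "dist x ?c = t * dist y x" using t by (simp add: dist_norm)
        also have "dist ?c z < t * e" using z by simp
        finally show ?thesis using t(3) by (simp add: D_def algebra_simps)
      qed
      ultimately show "z \<in> E \<inter> ball x \<rho>" by simp
    qed
    then have le: "measure lebesgue (ball ?c (t * e)) \<le> measure lebesgue (E \<inter> ball x \<rho>)"
      using E by (intro measure_mono_fmeasurable lmeasurable_open) (auto intro: bounded_subset[OF bounded_ball])
    have pos: "0 < measure lebesgue (ball x \<rho>)" using elim by (simp add: content_ball_pos)
    have "t * e = (e / D) * \<rho>" by (simp add: t_def)
    then have "measure lebesgue (ball ?c (t * e)) = ?q * measure lebesgue (ball x \<rho>)"
      using t y elim D by (subst (1 2) measure_ball_eq) (auto simp: power_mult_distrib power_divide)
    then show ?case using le pos by (simp add: pos_le_divide_eq)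
  qed
  then have "?q \<le> 0" by (rule tendsto_lowerbound[OF lim]) simp
  then show False using q by simp
qed

lemma density_one_open_convex:
  assumes "open E" "convex E" shows "density_one E = E"
  using not_density_one_outside[OF assms] has_density_interior[of _ E] assms
  by (auto simp: density_one_def interior_open)

lemma ess_boundary_open_convex:
  assumes "open E" "convex E" "E \<noteq> {}" shows "ess_boundary E = frontier E"
proof -
  have "x \<in> ess_boundary E \<longleftrightarrow> x \<in> frontier E" for x
  proof (cases "x \<in> E")
    case True
    then show ?thesis using has_density_interior[of x E] assms
      by (auto simp: ess_boundary_def frontier_def interior_open)
  next
    case False
    then show ?thesis
      using not_density_one_outside[OF assms(1,2) False] not_density_zero_closure[OF assms, of x] has_density_exterior[of x E] assms
      by (auto simp: ess_boundary_def frontier_def interior_open)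
  qed
  then show ?thesis by auto
qed

text \<open>A convex set and its interior differ by a null set and have the same density points, and an open
convex set is its own set of density points. So the representative singled out in the definition is
the open one.\<close>

lemma admissible_iff:
  fixes E :: "'a::euclidean_space set"
  assumes m: "0 < m"
  shows "E \<in> admissible m \<longleftrightarrow> open E \<and> convex E \<and> emeasure lebesgue E = ennreal m"
proof
  assume "open E \<and> convex E \<and> emeasure lebesgue E = ennreal m"
  then show "E \<in> admissible m" by (auto simp: admissible_def density_one_open_convex)
next
  assume "E \<in> admissible m"
  then have E: "E \<in> sets lebesgue" "density_one E = E" "convex E" "emeasure lebesgue E = ennreal m"
    by (auto simp: admissible_def simp del: emeasure_completion)
  have "sym_diff E (interior E) \<subseteq> frontier E"
    using interior_subset closure_subset by (auto simp: frontier_def)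
  then have "sym_diff E (interior E) \<in> null_sets lebesgue"
    using negligible_convex_frontier[OF E(3)] negligible_subset by (auto simp: negligible_iff_null_sets[symmetric])
  then have "has_density E x 1 \<longleftrightarrow> has_density (interior E) x 1" for x
    by (rule has_density_cong_null) (use E in auto)
  then have "density_one E = density_one (interior E)" by (simp add: density_one_def)
  also have "\<dots> = interior E" using E by (intro density_one_open_convex) (auto simp: convex_interior)
  finally have "open E" using E(2) by (metis open_interior)
  then show "open E \<and> convex E \<and> emeasure lebesgue E = ennreal m" using E by blast
qed

section \<open>The dilated boundary\<close>

text \<open>A ball is connected: it meets the frontier of \<open>E\<close> if and only if it meets both \<open>E\<close> and its
complement.\<close>

lemma nbhd_frontier:
  fixes E :: "'a::euclidean_space set"
  shows "nbhd \<rho> (frontier E) = nbhd \<rho> E \<inter> nbhd \<rho> (- E)"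
proof
  have "frontier E \<subseteq> closure E" "frontier E \<subseteq> closure (- E)"
    by (auto simp: frontier_closures)
  then show "nbhd \<rho> (frontier E) \<subseteq> nbhd \<rho> E \<inter> nbhd \<rho> (- E)"
    using nbhd_mono nbhd_closure by (metis Int_greatest order_refl)
  show "nbhd \<rho> E \<inter> nbhd \<rho> (- E) \<subseteq> nbhd \<rho> (frontier E)"
  proof
    fix y assume "y \<in> nbhd \<rho> E \<inter> nbhd \<rho> (- E)"
    then obtain a b where "a \<in> E" "dist a y < \<rho>" "b \<notin> E" "dist b y < \<rho>" by (auto simp: mem_nbhd)
    then have "a \<in> ball y \<rho> \<inter> E" "b \<in> ball y \<rho> - E" by (auto simp: dist_commute)
    then have "ball y \<rho> \<inter> E \<noteq> {}" "ball y \<rho> - E \<noteq> {}" by blast+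
    then have "ball y \<rho> \<inter> frontier E \<noteq> {}" by (intro connected_Int_frontier) auto
    then show "y \<in> nbhd \<rho> (frontier E)" by (auto simp: mem_nbhd dist_commute)
  qed
qed

text \<open>The inner parallel set: the points whose ball of radius \<open>\<rho>\<close> is contained in \<open>E\<close>. The dilation of
\<open>E\<close> is the disjoint union of the dilated frontier and this set.\<close>

definition core :: "real \<Rightarrow> 'a::metric_space set \<Rightarrow> 'a set" where
  "core \<rho> E = - nbhd \<rho> (- E)"

lemma closed_core: "closed (core \<rho> E)"
  by (simp add: core_def closed_Compl)

lemma core_subset: "0 < \<rho> \<Longrightarrow> core \<rho> E \<subseteq> E"
  using subset_nbhd[of \<rho> "- E"] by (auto simp: core_def)

lemma nbhd_core: "nbhd \<rho> (core \<rho> E) \<subseteq> E"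
  proof
  fix y assume "y \<in> nbhd \<rho> (core \<rho> E)"
  then obtain x where x: "x \<notin> nbhd \<rho> (- E)" "dist x y < \<rho>" by (auto simp: core_def mem_nbhd)
  then show "y \<in> E" by (metis ComplI dist_commute mem_nbhd)
qed

lemma nbhd_split: "0 < \<rho> \<Longrightarrow> nbhd \<rho> E = nbhd \<rho> (frontier E) \<union> core \<rho> E" for E :: "'a::euclidean_space set"
  using core_subset[of \<rho> E] subset_nbhd[of \<rho> E] unfolding nbhd_frontier by (auto simp: core_def)

lemma measure_nbhd_split:
  fixes E :: "'a::euclidean_space set"
  assumes "0 < \<rho>" "bounded E"
  shows "measure lebesgue (nbhd \<rho> E) = measure lebesgue (nbhd \<rho> (frontier E)) + measure lebesgue (core \<rho> E)"
proof -
  have "core \<rho> E \<in> lmeasurable"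
    using closed_core[of \<rho> E] core_subset[OF assms(1), of E] assms(2)
    by (intro lmeasurable_compact) (auto simp: compact_eq_bounded_closed intro: bounded_subset)
  moreover have "nbhd \<rho> (frontier E) \<in> lmeasurable" using bounded_subset[OF bounded_closure[OF assms(2)]] by (simp add: frontier_def)
  moreover have "nbhd \<rho> (frontier E) \<inter> core \<rho> E = {}" unfolding nbhd_frontier by (auto simp: core_def)
  ultimately have "measure lebesgue (nbhd \<rho> (frontier E) \<union> core \<rho> E) = measure lebesgue (nbhd \<rho> (frontier E)) + measure lebesgue (core \<rho> E)"
    by (intro measure_Union) (auto simp del: emeasure_completion simp: fmeasurable_def)
  then show ?thesis by (simp only: nbhd_split[OF assms(1), of E, symmetric])
qed

text \<open>Dilating the inner parallel set stays inside \<open>E\<close>, so the isoperimetric inequality for dilations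
bounds its volume from above; for the ball this bound is attained.\<close>

lemma measure_core_le_ball:
  fixes E :: "'a::euclidean_space set"
  assumes \<rho>: "0 < \<rho>" and R: "0 < R" and E: "bounded E" "E \<in> sets lebesgue"
    and m: "measure lebesgue E = measure lebesgue (ball (0::'a) R)"
  shows "measure lebesgue (core \<rho> E) \<le> measure lebesgue (core \<rho> (ball (0::'a) R))"
proof -
  have cpt: "compact (core \<rho> E)"
    using closed_core[of \<rho> E] core_subset[OF \<rho>, of E] E(1) by (auto simp: compact_eq_bounded_closed intro: bounded_subset)
  obtain q where q: "0 \<le> q" "measure lebesgue (ball (0::'a) q) = measure lebesgue (core \<rho> E)"
    using ex_ball_measure[of "measure lebesgue (core \<rho> E)"] by auto
  show ?thesis
  proof (cases "q = 0")
    case True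
    then show ?thesis using q by simp
  next
    case False
    then have "measure lebesgue (ball (0::'a) (q + \<rho>)) \<le> measure lebesgue (nbhd \<rho> (core \<rho> E))"
      using q \<rho> by (intro measure_nbhd_ge_ball[OF cpt]) auto
    also have "\<dots> \<le> measure lebesgue E"
      using nbhd_core[of \<rho> E] E by (intro measure_mono_fmeasurable) (auto intro: bounded_set_imp_lmeasurable)
    finally have "q + \<rho> \<le> R" unfolding m using measure_ball_mono_iff[of "q + \<rho>" R "0::'a" 0] q \<rho> R by simp
    have "ball (0::'a) q \<subseteq> core \<rho> (ball 0 R)"
    proof
      fix x :: 'a assume x: "x \<in> ball 0 q"
      have "y \<in> ball 0 R" if "dist y x < \<rho>" for y
        using that x \<open>q + \<rho> \<le> R\<close> norm_triangle_sub[of y x] by (simp add: dist_norm)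
      then show "x \<in> core \<rho> (ball 0 R)" by (auto simp: core_def mem_nbhd)
    qed
    moreover have "core \<rho> (ball (0::'a) R) \<in> lmeasurable"
      using closed_core[of \<rho> "ball (0::'a) R"] core_subset[OF \<rho>, of "ball (0::'a) R"]
      by (intro lmeasurable_compact) (auto simp: compact_eq_bounded_closed intro: bounded_subset)
    ultimately show ?thesis unfolding q(2)[symmetric] by (intro measure_mono_fmeasurable) auto
  qed
qed

text \<open>The dilation of \<open>E\<close> exceeds that of the ball by at most the excess of the dilated boundaries,
because the inner parallel set is largest for the ball. So near-minimality for the perimeter gives
near-minimality for the volume of the full dilation, to which \<open>ball_stability\<close> applies.\<close>

lemma measure_nbhd_le_ball_add_boundary_excess:
  fixes E :: "'a::euclidean_space set"
  assumes \<rho>: "0 < \<rho>" and R: "0 < R" and E: "bounded E" "E \<in> sets lebesgue"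
    and m: "measure lebesgue E = measure lebesgue (ball (0::'a) R)"
  shows "measure lebesgue (nbhd \<rho> E) \<le> measure lebesgue (ball (0::'a) (R + \<rho>))
    + (measure lebesgue (nbhd \<rho> (frontier E)) - measure lebesgue (nbhd \<rho> (frontier (ball (0::'a) R))))"
  using measure_nbhd_split[OF \<rho> E(1)] measure_nbhd_split[OF \<rho> bounded_ball[of "0::'a" R]] measure_core_le_ball[OF assms]
    nbhd_ball[OF R \<rho>, of "0::'a"] by simp

lemma Per_open_convex:
  fixes E :: "'a::euclidean_space set"
  assumes "open E" "convex E" "E \<noteq> {}"
  shows "Per \<rho> E = ennreal (1 / (2 * \<rho>)) * emeasure lebesgue (nbhd \<rho> (frontier E))"
  by (simp add: Per_def ess_boundary_open_convex[OF assms] nbhd_def)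

lemma convex_finite_Per_bounded:
  fixes E :: "'a::euclidean_space set"
  assumes E: "convex E" "E \<in> lmeasurable" and \<rho>: "0 < \<rho>" and fin: "emeasure lebesgue (nbhd \<rho> (frontier E)) < \<infinity>"
  shows "nbhd \<rho> E \<in> lmeasurable" "bounded E"
    "measure lebesgue (nbhd \<rho> E) \<le> measure lebesgue (nbhd \<rho> (frontier E)) + measure lebesgue E"
proof -
  have f: "nbhd \<rho> (frontier E) \<in> lmeasurable" using fin by (auto simp: fmeasurable_def)
  have sub: "nbhd \<rho> E \<subseteq> nbhd \<rho> (frontier E) \<union> E"
    using nbhd_split[OF \<rho>, of E] core_subset[OF \<rho>, of E] by auto
  have U: "nbhd \<rho> (frontier E) \<union> E \<in> lmeasurable" using f E(2) by (rule fmeasurable.Un)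
  show n: "nbhd \<rho> E \<in> lmeasurable" using fmeasurableI2[OF U sub] by simp
  have "measure lebesgue (nbhd \<rho> E) \<le> measure lebesgue (nbhd \<rho> (frontier E) \<union> E)"
    using U sub by (intro measure_mono_fmeasurable) auto
  also have "\<dots> \<le> measure lebesgue (nbhd \<rho> (frontier E)) + measure lebesgue E"
    using f E by (intro measure_Un_le) (auto dest: fmeasurableD)
  finally show "measure lebesgue (nbhd \<rho> E) \<le> measure lebesgue (nbhd \<rho> (frontier E)) + measure lebesgue E" .
  show "bounded E"
  proof (cases "E = {}")
    case False
    then obtain x where "x \<in> E" by auto
    then show ?thesis using convex_diameter_bound[OF E(1) \<rho> n] unfolding bounded_def by blast
  qed simp
qed

section \<open>The Riesz energy\<close>

lemma riesz_energy_lborel: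
  fixes E :: "'a::euclidean_space set"
  shows "riesz_energy \<alpha> E = (\<integral>\<^sup>+x. (\<integral>\<^sup>+y. ennreal (1 / norm (x - y) powr \<alpha>) * indicator E y \<partial>lborel) * indicator E x \<partial>lborel)"
  by (simp add: riesz_energy_def nn_integral_completion)

lemma nn_integral_lborel_translate:
  fixes f :: "'a::euclidean_space \<Rightarrow> ennreal"
  assumes "f \<in> borel_measurable borel"
  shows "(\<integral>\<^sup>+x. f (t + x) \<partial>lborel) = (\<integral>\<^sup>+x. f x \<partial>lborel)"
proof -
  have "(\<integral>\<^sup>+x. f x \<partial>lborel) = (\<integral>\<^sup>+x. f x \<partial>distr lborel borel ((+) t))" by (simp add: lborel_distr_plus)
  also have "\<dots> = (\<integral>\<^sup>+x. f (t + x) \<partial>lborel)" using assms by (subst nn_integral_distr) auto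
  finally show ?thesis by simp
qed

lemma riesz_energy_translation:
  fixes E :: "'a::euclidean_space set"
  assumes [measurable]: "E \<in> sets borel"
  shows "riesz_energy \<alpha> ((+) t ` E) = riesz_energy \<alpha> E"
proof -
  have T[measurable]: "(+) t ` E \<in> sets borel"
  proof -
    have "(+) t ` E = (\<lambda>x. x - t) -` E" by (auto simp: image_iff) (metis add.commute diff_add_cancel)
    then show ?thesis using measurable_sets[of "\<lambda>x. x - t" borel borel E] assms by simp
  qed
  have ind: "indicator ((+) t ` E) (t + x) = (indicator E x :: ennreal)" for x
    by (auto simp: indicator_def)
  let ?k = "\<lambda>x y. ennreal (1 / norm (x - y) powr \<alpha>) * indicator ((+) t ` E) y"
  have inner: "(\<integral>\<^sup>+y. ?k x y \<partial>lborel) = (\<integral>\<^sup>+y. ?k x (t + y) \<partial>lborel)" for x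
    by (rule nn_integral_lborel_translate[symmetric]) measurable
  have "riesz_energy \<alpha> ((+) t ` E) = (\<integral>\<^sup>+x. (\<integral>\<^sup>+y. ?k x y \<partial>lborel) * indicator ((+) t ` E) x \<partial>lborel)"
    by (rule riesz_energy_lborel)
  also have "\<dots> = (\<integral>\<^sup>+x. (\<integral>\<^sup>+y. ?k (t + x) y \<partial>lborel) * indicator ((+) t ` E) (t + x) \<partial>lborel)"
    by (rule nn_integral_lborel_translate[symmetric]) measurable
  also have "\<dots> = riesz_energy \<alpha> E"
    unfolding inner riesz_energy_lborel ind by simp
  finally show ?thesis .
qed

text \<open>The Riesz potential at the centre of a ball of radius \<open>T\<close>. Only numbers occur among the other
arguments, so the space has to be passed as a type argument.\<close>

definition riesz_potential :: "'a::euclidean_space itself \<Rightarrow> real \<Rightarrow> real \<Rightarrow> ennreal" where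
  "riesz_potential _ \<alpha> T = (\<integral>\<^sup>+y. ennreal (1 / norm (y :: 'a) powr \<alpha>) * indicator (ball 0 T) y \<partial>lborel)"

text \<open>Dyadic decomposition: on the shell with radii between \<open>T / 2 ^ Suc k\<close> and \<open>T / 2 ^ k\<close> the kernel is
at most its value at the inner radius, and the resulting bounds form a geometric series with ratio
\<open>2 powr (\<alpha> - n)\<close>, where \<open>n\<close> is the dimension.\<close>

lemma riesz_potential_finite:
  assumes \<alpha>: "0 < \<alpha>" "\<alpha> < real DIM('a::euclidean_space)" and T: "0 < T"
  shows "riesz_potential TYPE('a) \<alpha> T < \<infinity>"
proof -
  let ?n = "DIM('a)"
  let ?\<omega> = "unit_ball_vol (real ?n)"
  have \<omega>: "0 \<le> ?\<omega>" by (rule unit_ball_vol_nonneg) simp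
  define b where "b k = T / 2 ^ k" for k :: nat
  have b: "0 < b k" for k using T by (simp add: b_def)
  define C where "C = (T/2) powr (-\<alpha>) * ?\<omega> * T ^ ?n"
  define q where "q = 2 powr (\<alpha> - real ?n)"
  have q: "0 \<le> q" "q < 1"
    using \<alpha> powr_less_cancel_iff[of 2 "\<alpha> - real ?n" 0] by (auto simp: q_def)
  have ptw: "ennreal (1 / norm y powr \<alpha>) * indicator (ball 0 T) y \<le>
      (\<Sum>k. ennreal (b (Suc k) powr (-\<alpha>)) * indicator (ball 0 (b k)) y)" (is "_ \<le> (\<Sum>k. ?g k)") for y :: 'a
  proof (cases "y \<in> ball 0 T \<and> y \<noteq> 0")
    case True
    have "b \<longlonglongrightarrow> 0" unfolding b_def by (rule LIMSEQ_divide_realpow_zero) simp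
    then have "\<forall>\<^sub>F k in sequentially. b k < norm y" using True by (intro order_tendstoD) auto
    then obtain j0 where j0: "b j0 \<le> norm y" by (auto simp: eventually_sequentially intro: less_imp_le)
    \<comment> \<open>The index of the shell of \<open>y\<close> is the predecessor of the first \<open>k\<close> with \<open>b k \<le> norm y\<close>.\<close>
    define j where "j = (LEAST k. b k \<le> norm y)"
    have j1: "b j \<le> norm y" unfolding j_def by (rule LeastI[of _ j0]) (rule j0)
    have "j \<noteq> 0"
    proof
      assume "j = 0"
      then show False using j1 True by (simp add: b_def)
    qed
    then obtain k where k: "j = Suc k" by (cases j) auto
    have "\<not> b k \<le> norm y" using not_less_Least[of k "\<lambda>k. b k \<le> norm y"] k by (simp add: j_def)
    then have in_k: "y \<in> ball 0 (b k)" by simp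
    have "b (Suc k) powr \<alpha> \<le> norm y powr \<alpha>" using j1 k b \<alpha> by (intro powr_mono2) (auto intro: less_imp_le)
    then have "1 / norm y powr \<alpha> \<le> b (Suc k) powr (-\<alpha>)"
      using b[of "Suc k"] by (simp add: powr_minus_divide frac_le)
    then have "ennreal (1 / norm y powr \<alpha>) * indicator (ball 0 T) y \<le> ?g k"
      using in_k True by (simp add: ennreal_leI)
    also have "\<dots> = (\<Sum>i\<in>{k}. ?g i)" by (subst sum.insert) simp_all
    also have "\<dots> \<le> (\<Sum>k. ?g k)" by (rule sum_le_suminf) auto
    finally show ?thesis .
  next
    case False
    then have "ennreal (1 / norm y powr \<alpha>) * indicator (ball 0 T) y = 0" by (auto simp: indicator_def)
    then show ?thesis by (simp only: zero_le)
  qed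
  have shell: "(\<integral>\<^sup>+y. ennreal (b (Suc k) powr (-\<alpha>)) * indicator (ball (0::'a) (b k)) y \<partial>lborel) = ennreal (C * q ^ k)" for k
  proof -
    have "(\<integral>\<^sup>+y. ennreal (b (Suc k) powr (-\<alpha>)) * indicator (ball (0::'a) (b k)) y \<partial>lborel)
        = ennreal (b (Suc k) powr (-\<alpha>)) * emeasure lborel (ball (0::'a) (b k))"
      by (simp add: nn_integral_cmult_indicator)
    also have "emeasure lborel (ball (0::'a) (b k)) = ennreal (?\<omega> * b k ^ ?n)"
      using b[of k] by (intro emeasure_ball) simp
    also have "ennreal (b (Suc k) powr (-\<alpha>)) * \<dots> = ennreal (b (Suc k) powr (-\<alpha>) * (?\<omega> * b k ^ ?n))"
      by (simp add: ennreal_mult')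
    also have "b (Suc k) powr (-\<alpha>) * (?\<omega> * b k ^ ?n) = C * q ^ k"
    proof -
      have "b (Suc k) = (T/2) * 2 powr (- real k)" by (simp add: b_def powr_minus powr_realpow field_simps)
      then have e1: "b (Suc k) powr (-\<alpha>) = (T/2) powr (-\<alpha>) * 2 powr (real k * \<alpha>)"
        using T by (simp only: powr_mult powr_powr) simp
      have "b k ^ ?n = T ^ ?n * 2 powr (- (real k * real ?n))"
        using powr_realpow[of 2 "k * ?n"] by (simp add: b_def power_divide power_mult[symmetric] powr_minus_divide)
      then have "b (Suc k) powr (-\<alpha>) * (?\<omega> * b k ^ ?n) = C * (2 powr (real k * \<alpha>) * 2 powr (- (real k * real ?n)))"
        by (simp add: e1 C_def)
      also have "2 powr (real k * \<alpha>) * 2 powr (- (real k * real ?n)) = 2 powr ((\<alpha> - real ?n) * real k)"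
        by (simp add: powr_add[symmetric] algebra_simps)
      also have "\<dots> = q ^ k" by (simp add: q_def powr_powr[symmetric] powr_realpow)
      finally show ?thesis .
    qed
    finally show ?thesis .
  qed
  have "riesz_potential TYPE('a) \<alpha> T \<le> (\<integral>\<^sup>+y. (\<Sum>k. ennreal (b (Suc k) powr (-\<alpha>)) * indicator (ball (0::'a) (b k)) y) \<partial>lborel)"
    unfolding riesz_potential_def by (intro nn_integral_mono ptw)
  also have "\<dots> = (\<Sum>k. ennreal (C * q ^ k))"
    by (subst nn_integral_suminf) (simp_all only: shell borel_measurable_times_ennreal borel_measurable_const borel_measurable_indicator sets_lborel borel_open open_ball)
  also have "\<dots> = ennreal (\<Sum>k. C * q ^ k)"
    using q T \<omega> by (intro suminf_ennreal2) (auto simp: C_def intro!: summable_mult summable_geometric)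
  also have "\<dots> < \<infinity>" by simp
  finally show ?thesis .
qed

lemma riesz_potential_mono: "S \<le> T \<Longrightarrow> riesz_potential TYPE('a::euclidean_space) \<alpha> S \<le> riesz_potential TYPE('a) \<alpha> T"
  unfolding riesz_potential_def by (intro nn_integral_mono mult_left_mono) (auto simp: indicator_def)

lemma riesz_energy_ball_le:
  "riesz_energy \<alpha> (ball (0::'a::euclidean_space) R) \<le> emeasure lborel (ball (0::'a) R) * riesz_potential TYPE('a) \<alpha> (2 * R)"
proof -
  let ?B = "ball (0::'a) R"
  have [measurable]: "?B \<in> sets borel" by simp
  have inner: "(\<integral>\<^sup>+y. ennreal (1 / norm (x - y) powr \<alpha>) * indicator ?B y \<partial>lborel) \<le> riesz_potential TYPE('a) \<alpha> (2 * R)"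
    if x: "x \<in> ?B" for x
  proof -
    have "(\<integral>\<^sup>+y. ennreal (1 / norm (x - y) powr \<alpha>) * indicator ?B y \<partial>lborel)
        = (\<integral>\<^sup>+y. ennreal (1 / norm (x - (x + y)) powr \<alpha>) * indicator ?B (x + y) \<partial>lborel)"
      by (rule nn_integral_lborel_translate[symmetric]) measurable
    also have "\<dots> \<le> riesz_potential TYPE('a) \<alpha> (2 * R)"
      unfolding riesz_potential_def
    proof (intro nn_integral_mono)
      fix y :: 'a
      have "norm y < 2 * R" if "norm (x + y) < R"
        using that x norm_triangle_ineq4[of "x + y" x] by simp
      then show "ennreal (1 / norm (x - (x + y)) powr \<alpha>) * indicator ?B (x + y) \<le> ennreal (1 / norm y powr \<alpha>) * indicator (ball 0 (2 * R)) y"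
        by (auto simp: indicator_def)
    qed
    finally show ?thesis .
  qed
  have "riesz_energy \<alpha> ?B \<le> (\<integral>\<^sup>+x. riesz_potential TYPE('a) \<alpha> (2 * R) * indicator ?B x \<partial>lborel)"
    unfolding riesz_energy_lborel using inner by (intro nn_integral_mono) (auto simp: indicator_def)
  also have "\<dots> = riesz_potential TYPE('a) \<alpha> (2 * R) * emeasure lborel ?B"
    by (simp add: nn_integral_cmult_indicator)
  finally show ?thesis by (simp add: mult.commute)
qed

section \<open>Lower semicontinuity\<close>

lemma emeasure_fatou:
  fixes A :: "'a::euclidean_space set"
  assumes [measurable]: "A \<in> sets borel" "\<And>i. B i \<in> sets borel"
    and ev: "\<And>x. x \<in> A \<Longrightarrow> \<forall>\<^sub>F i in sequentially. x \<in> B i"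
  shows "emeasure lborel A \<le> liminf (\<lambda>i. emeasure lborel (B i))"
proof -
  have "indicator A x \<le> liminf (\<lambda>i. indicator (B i) x :: ennreal)" for x
  proof (cases "x \<in> A")
    case True
    then show ?thesis by (intro Liminf_bounded eventually_mono[OF ev[OF True]]) (auto simp: indicator_def)
  qed simp
  then have "(\<integral>\<^sup>+x. indicator A x \<partial>lborel) \<le> (\<integral>\<^sup>+x. liminf (\<lambda>i. indicator (B i) x) \<partial>lborel)"
    by (intro nn_integral_mono)
  also have "\<dots> \<le> liminf (\<lambda>i. \<integral>\<^sup>+x. indicator (B i) x \<partial>lborel)"
    by (rule nn_integral_liminf) measurable
  finally show ?thesis by simp
qed

lemma riesz_energy_fatou:
  fixes A :: "'a::euclidean_space set"
  assumes [measurable]: "A \<in> sets borel" "\<And>i. B i \<in> sets borel"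
    and ev: "\<And>x. x \<in> A \<Longrightarrow> \<forall>\<^sub>F i in sequentially. x \<in> B i"
  shows "riesz_energy \<alpha> A \<le> liminf (\<lambda>i. riesz_energy \<alpha> (B i))"
proof -
  let ?k = "\<lambda>x y. ennreal (1 / norm (x - y :: 'a) powr \<alpha>)"
  let ?g = "\<lambda>E x. \<integral>\<^sup>+y. ?k x y * indicator E y \<partial>lborel"
  have inner: "?g A x \<le> liminf (\<lambda>i. ?g (B i) x)" for x
  proof -
    have "?k x y * indicator A y \<le> liminf (\<lambda>i. ?k x y * indicator (B i) y)" for y
    proof (cases "y \<in> A")
      case True
      then show ?thesis by (intro Liminf_bounded eventually_mono[OF ev[OF True]]) (auto simp: indicator_def)
    qed simp
    then have "?g A x \<le> (\<integral>\<^sup>+y. liminf (\<lambda>i. ?k x y * indicator (B i) y) \<partial>lborel)"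
      by (intro nn_integral_mono)
    also have "\<dots> \<le> liminf (\<lambda>i. ?g (B i) x)" by (rule nn_integral_liminf) measurable
    finally show ?thesis .
  qed
  have "?g A x * indicator A x \<le> liminf (\<lambda>i. ?g (B i) x * indicator (B i) x)" for x
  proof (cases "x \<in> A")
    case True
    have "liminf (\<lambda>i. ?g (B i) x) \<le> liminf (\<lambda>i. ?g (B i) x * indicator (B i) x)"
      by (intro Liminf_mono eventually_mono[OF ev[OF True]]) (auto simp: indicator_def)
    then show ?thesis using inner[of x] True by simp
  qed simp
  then have "riesz_energy \<alpha> A \<le> (\<integral>\<^sup>+x. liminf (\<lambda>i. ?g (B i) x * indicator (B i) x) \<partial>lborel)"
    unfolding riesz_energy_lborel by (intro nn_integral_mono)
  also have "\<dots> \<le> liminf (\<lambda>i. riesz_energy \<alpha> (B i))"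
    unfolding riesz_energy_lborel by (rule nn_integral_liminf) measurable
  finally show ?thesis .
qed

lemma ennreal_mult_liminf_le:
  fixes a :: "nat \<Rightarrow> ennreal"
  shows "c * liminf a \<le> liminf (\<lambda>i. c * a i)"
proof -
  have "c * liminf a = (SUP n. c * (INF k\<in>{n..}. a k))"
    unfolding liminf_SUP_INF by (rule SUP_mult_left_ennreal)
  also have "\<dots> \<le> liminf (\<lambda>i. c * a i)"
    unfolding liminf_SUP_INF by (intro SUP_mono) (auto intro!: INF_greatest mult_left_mono INF_lower exI)
  finally show ?thesis .
qed

lemma ennreal_liminf_add_le:
  fixes a b :: "nat \<Rightarrow> ennreal"
  shows "liminf a + liminf b \<le> liminf (\<lambda>i. a i + b i)"
proof -
  have inc: "incseq (\<lambda>n. INF k\<in>{n..}. f k)" for f :: "nat \<Rightarrow> ennreal"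
    unfolding incseq_def by (intro allI impI INF_superset_mono) auto
  have "liminf a + liminf b = (SUP n. (INF k\<in>{n..}. a k) + (INF k\<in>{n..}. b k))"
    unfolding liminf_SUP_INF by (rule ennreal_SUP_add[symmetric]) (rule inc)+
  also have "\<dots> \<le> liminf (\<lambda>i. a i + b i)"
    unfolding liminf_SUP_INF by (intro SUP_mono) (auto intro!: INF_greatest add_mono INF_lower exI)
  finally show ?thesis .
qed

section \<open>Existence of minimizers\<close>

lemma admissible_ball:
  assumes "0 < m"
  obtains R where "0 < R" "measure lebesgue (ball (0::'a::euclidean_space) R) = m" "ball (0::'a) R \<in> admissible m"
proof -
  obtain R where R: "0 \<le> R" "measure lebesgue (ball (0::'a) R) = m"
    using ex_ball_measure[of m] assms by auto
  then have "0 < R" using assms by (cases "R = 0") auto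
  moreover have "emeasure lebesgue (ball (0::'a) R) = ennreal m"
    using R(2) emeasure_eq_measure2[OF lmeasurable_ball, of "0::'a" R] by simp
  ultimately show ?thesis using that R(2) admissible_iff[OF assms, of "ball (0::'a) R"] by auto
qed

lemma admissibleD:
  fixes E :: "'a::euclidean_space set"
  assumes m: "0 < m" and E: "E \<in> admissible m"
  shows "open E" "convex E" "E \<noteq> {}" "E \<in> lmeasurable" "measure lebesgue E = m" "emeasure lebesgue E = ennreal m"
proof -
  show *: "open E" "convex E" "emeasure lebesgue E = ennreal m" using E unfolding admissible_iff[OF m] by auto
  then show "E \<in> lmeasurable" by (auto simp: fmeasurable_def simp del: emeasure_completion)
  show "measure lebesgue E = m" using *(3) m by (simp add: measure_def del: emeasure_completion)
  then show "E \<noteq> {}" using m by auto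
qed

lemma energy_eq:
  fixes E :: "'a::euclidean_space set"
  assumes "0 < m" "E \<in> admissible m" and \<rho>: "\<rho> = r * m powr (1 / real DIM('a))"
  shows "energy \<alpha> r m E = ennreal (1 / (2 * \<rho>)) * emeasure lebesgue (nbhd \<rho> (frontier E)) + riesz_energy \<alpha> E"
  using admissibleD[OF assms(1,2)] by (simp add: energy_def Per_open_convex \<rho> del: emeasure_completion)

lemma nbhd_frontier_le_energy:
  fixes E :: "'a::euclidean_space set"
  assumes m: "0 < m" and r: "0 < r" and E: "E \<in> admissible m" and \<rho>: "\<rho> = r * m powr (1 / real DIM('a))"
    and c: "0 \<le> c" "energy \<alpha> r m E \<le> ennreal c"
  shows "emeasure lebesgue (nbhd \<rho> (frontier E)) \<le> ennreal (2 * \<rho> * c)"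
proof -
  let ?x = "emeasure lebesgue (nbhd \<rho> (frontier E))"
  have \<rho>0: "0 < \<rho>" using m r by (simp add: \<rho>)
  have "ennreal (1 / (2 * \<rho>)) * ?x \<le> ennreal c"
  proof (rule order_trans[OF _ c(2)])
    show "ennreal (1 / (2 * \<rho>)) * ?x \<le> energy \<alpha> r m E"
      unfolding energy_eq[OF m E \<rho>] by (rule add_increasing2[OF zero_le order_refl])
  qed
  then have "ennreal (2 * \<rho>) * (ennreal (1 / (2 * \<rho>)) * ?x) \<le> ennreal (2 * \<rho>) * ennreal c"
    by (rule mult_left_mono) simp
  moreover have "ennreal (2 * \<rho>) * (ennreal (1 / (2 * \<rho>)) * ?x) = ?x"
    using \<rho>0 by (simp add: mult.assoc[symmetric] ennreal_mult'[symmetric] del: emeasure_completion)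
  ultimately show ?thesis using \<rho>0 c(1) by (simp add: ennreal_mult'[symmetric] del: emeasure_completion)
qed

lemma energy_ball_le:
  assumes m: "0 < m" and r: "0 < r" and B: "ball (0::'a::euclidean_space) R \<in> admissible m"
    and \<rho>: "\<rho> = r * m powr (1 / real DIM('a))"
    and C: "0 \<le> C" "riesz_potential TYPE('a) \<alpha> (2 * R) \<le> ennreal C"
  shows "energy \<alpha> r m (ball (0::'a) R) \<le> ennreal (measure lebesgue (nbhd \<rho> (frontier (ball (0::'a) R))) / (2 * \<rho>) + m * C)"
proof -
  let ?N = "nbhd \<rho> (frontier (ball (0::'a) R))"
  have \<rho>0: "0 < \<rho>" using m r by (simp add: \<rho>)
  have "?N \<in> lmeasurable" by (intro lmeasurable_nbhd) (metis bounded_ball bounded_closure bounded_subset frontier_def Diff_subset)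
  then have "ennreal (1 / (2 * \<rho>)) * emeasure lebesgue ?N = ennreal (measure lebesgue ?N / (2 * \<rho>))"
    using \<rho>0 by (simp add: emeasure_eq_measure2 ennreal_mult'[symmetric] del: emeasure_completion)
  moreover have "riesz_energy \<alpha> (ball (0::'a) R) \<le> ennreal (m * C)"
  proof -
    have "riesz_energy \<alpha> (ball (0::'a) R) \<le> emeasure lborel (ball (0::'a) R) * riesz_potential TYPE('a) \<alpha> (2 * R)"
      by (rule riesz_energy_ball_le)
    also have "emeasure lborel (ball (0::'a) R) = ennreal m" using admissibleD(6)[OF m B] by simp
    also have "ennreal m * riesz_potential TYPE('a) \<alpha> (2 * R) \<le> ennreal m * ennreal C" using C by (intro mult_left_mono) auto
    also have "\<dots> = ennreal (m * C)" using m by (simp add: ennreal_mult')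
    finally show ?thesis .
  qed
  ultimately show ?thesis unfolding energy_eq[OF m B \<rho>] using m C \<rho>0 by (simp add: ennreal_plus)
qed

lemma energy_translation:
  fixes E :: "'a::euclidean_space set"
  assumes m: "0 < m" and E: "E \<in> admissible m"
  shows "(+) t ` E \<in> admissible m" "energy \<alpha> r m ((+) t ` E) = energy \<alpha> r m E"
proof -
  have em: "emeasure lebesgue ((+) t ` S) = emeasure lebesgue S" for S :: "'a set"
    using emeasure_lebesgue_affine[of 1 t S] by (simp add: add.commute del: emeasure_completion)
  show T: "(+) t ` E \<in> admissible m"
    using E unfolding admissible_iff[OF m] em by (auto intro: open_translation convex_translation)
  show "energy \<alpha> r m ((+) t ` E) = energy \<alpha> r m E"
    unfolding energy_eq[OF m E refl] energy_eq[OF m T refl] frontier_translation nbhd_translation em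
    using admissibleD(1)[OF m E] by (subst riesz_energy_translation) auto
qed

text \<open>Otherwise a hyperplane would separate a point near \<open>x\<close> from \<open>K i\<close>, and a point of \<open>L\<close> slightly
beyond this hyperplane could not be close to \<open>K i\<close>.\<close>

lemma hconv_interior:
  fixes L :: "'a::euclidean_space set"
  assumes h: "hconv K L" and K: "\<And>i. closed (K i)" "\<And>i. convex (K i)" and x: "x \<in> interior L"
  shows "\<forall>\<^sub>F i in sequentially. x \<in> interior (K i)"
proof -
  obtain \<epsilon> where \<epsilon>: "0 < \<epsilon>" "cball x \<epsilon> \<subseteq> L" using x by (meson mem_interior_cball)
  define e where "e = \<epsilon> / 2"
  have e: "0 < e" using \<epsilon> by (simp add: e_def)
  show ?thesis using hconvD[OF h e]
  proof eventually_elim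
    case (elim i)
    have "ball x e \<subseteq> K i"
    proof
      fix z assume z: "z \<in> ball x e"
      show "z \<in> K i"
      proof (rule ccontr)
        assume "z \<notin> K i"
        then obtain a b where ab: "a \<bullet> z < b" "\<And>y. y \<in> K i \<Longrightarrow> b < a \<bullet> y"
          using separating_hyperplane_closed_point[OF K(2,1)] by blast
        let ?w = "z - (e / norm a) *\<^sub>R a"
        have "dist z ?w \<le> e" using e by (simp add: dist_norm)
        then have "dist x ?w \<le> \<epsilon>" using z dist_triangle[of x ?w z] by (simp add: e_def)
        then have "?w \<in> L" using \<epsilon>(2) by auto
        then obtain y where y: "y \<in> K i" "dist y ?w < e" using elim by (auto simp: mem_nbhd subset_iff)
        have "a \<noteq> 0" using ab y(1) by force
        have "a \<bullet> y = a \<bullet> ?w + a \<bullet> (y - ?w)" by (simp add: inner_diff_right)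
        also have "a \<bullet> ?w = a \<bullet> z - e * norm a"
          using \<open>a \<noteq> 0\<close> by (simp add: inner_diff_right power2_norm_eq_inner[symmetric] power2_eq_square)
        also have "a \<bullet> (y - ?w) \<le> norm a * norm (y - ?w)" by (rule norm_cauchy_schwarz)
        also have "norm a * norm (y - ?w) \<le> norm a * e" using y(2) by (intro mult_left_mono) (auto simp: dist_norm)
        finally show False using ab y(1) by (simp add: mult.commute) (meson less_trans not_less order_less_le_trans)
      qed
    qed
    then show ?case using e by (auto simp: mem_interior)
  qed
qed

lemma hconv_exterior:
  fixes L :: "'a::metric_space set"
  assumes h: "hconv K L" and L: "closed L" and z: "z \<notin> L"
  shows "\<forall>\<^sub>F i in sequentially. z \<notin> K i"
proof -
  have "open (- L)" using L by auto
  then obtain e where e: "0 < e" "ball z e \<subseteq> - L" using z by (meson ComplI openE)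
  show ?thesis using hconvD[OF h e(1)]
  proof eventually_elim
    case (elim i)
    show ?case
    proof
      assume "z \<in> K i"
      then have "z \<in> nbhd e L" using elim by blast
      then obtain x where "x \<in> L" "dist x z < e" by (auto simp: mem_nbhd)
      then have "x \<in> ball z e" by (simp add: dist_commute)
      then show False using e(2) \<open>x \<in> L\<close> by blast
    qed
  qed
qed

text \<open>The direct method. Along a minimizing sequence the perimeters are bounded, hence so are the
diameters, and after translations there is a Hausdorff limit \<open>L\<close>. Points of the interior of \<open>L\<close>
eventually belong to the sets of the sequence, points outside \<open>L\<close> eventually do not. By Fatou's
lemma both terms of the energy and the volume are lower semicontinuous; upper semicontinuity of the
volume shows that no mass is lost.\<close>

theorem exists_minimizer:
  assumes \<alpha>: "0 < \<alpha>" "\<alpha> < real DIM('a::euclidean_space)" and r: "0 < r" and m: "0 < m"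
  shows "\<exists>E :: 'a set. is_minimizer \<alpha> r m E"
proof -
  define \<rho> where "\<rho> = r * m powr (1 / real DIM('a))"
  have \<rho>: "0 < \<rho>" using m r by (simp add: \<rho>_def)
  let ?en = "energy \<alpha> r m :: 'a set \<Rightarrow> ennreal"
  define I where "I = (INF E\<in>admissible m. ?en E)"
  obtain R where R: "0 < R" "ball (0::'a) R \<in> admissible m" using admissible_ball[OF m] by metis
  obtain C where C: "0 \<le> C" "riesz_potential TYPE('a) \<alpha> (2 * R) = ennreal C"
    using riesz_potential_finite[OF \<alpha>, of "2 * R"] R(1) by (auto simp: less_top_ennreal)
  have "I \<le> ?en (ball 0 R)" unfolding I_def by (rule INF_lower[OF R(2)])
  also have "\<dots> < \<infinity>" using energy_ball_le[OF m r R(2) \<rho>_def C(1), of \<alpha>] C(2) by (auto intro: le_less_trans)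
  finally obtain c where c: "0 \<le> c" "I = ennreal c" by (auto simp: less_top_ennreal)
  have "\<exists>E\<in>admissible m. ?en E < I + ennreal (1 / real (Suc i))" for i
    by (rule INF_approx_ennreal) (use c I_def in auto)
  then obtain E where E: "\<And>i. E i \<in> admissible m" "\<And>i. ?en (E i) < I + ennreal (1 / real (Suc i))" by metis
  define D where "D = 2 * \<rho> * (c + 1) + m"
  have Ebd: "nbhd \<rho> (E i) \<in> lmeasurable" "measure lebesgue (nbhd \<rho> (E i)) \<le> D" for i
  proof -
    have "?en (E i) \<le> ennreal c + ennreal (1 / real (Suc i))" using E(2)[of i] c by simp
    also have "\<dots> \<le> ennreal c + ennreal 1" by (intro add_left_mono ennreal_leI) simp
    also have "\<dots> = ennreal (c + 1)" using c(1) by (subst ennreal_plus[symmetric]) auto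
    finally have le: "emeasure lebesgue (nbhd \<rho> (frontier (E i))) \<le> ennreal (2 * \<rho> * (c + 1))"
      using c(1) by (intro nbhd_frontier_le_energy[OF m r E(1) \<rho>_def, of "c + 1" \<alpha>]) auto
    then have fin: "emeasure lebesgue (nbhd \<rho> (frontier (E i))) < \<infinity>" by (rule le_less_trans) simp
    note b = convex_finite_Per_bounded[OF admissibleD(2,4)[OF m E(1)[of i]] \<rho> fin]
    show "nbhd \<rho> (E i) \<in> lmeasurable" by (rule b(1))
    have "measure lebesgue (nbhd \<rho> (frontier (E i))) \<le> 2 * \<rho> * (c + 1)"
      unfolding measure_def using enn2real_mono[OF le] \<rho> c(1) by (simp del: emeasure_completion)
    then show "measure lebesgue (nbhd \<rho> (E i)) \<le> D"
      using b(3) admissibleD(5)[OF m E(1)[of i]] by (simp add: D_def)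
  qed
  define M where "M = 2 * \<rho> * (D / measure lebesgue (ball (0::'a) \<rho>) + 1)"
  have "\<exists>z. z \<in> E i" for i using admissibleD(3)[OF m E(1)[of i]] by blast
  then obtain a where a: "\<And>i. a i \<in> E i" by metis
  define F where "F i = (+) (- a i) ` E i" for i
  have Fadm: "F i \<in> admissible m" for i unfolding F_def by (rule energy_translation(1)[OF m E(1)])
  have Fen: "?en (F i) < I + ennreal (1 / real (Suc i))" for i
    unfolding F_def energy_translation(2)[OF m E(1)] by (rule E(2))
  note Fop = admissibleD[OF m Fadm]
  have Fsub: "closure (F i) \<subseteq> cball 0 M" for i
  proof -
    have "norm (z - a i) \<le> M" if z: "z \<in> E i" for z
    proof -
      have "dist z (a i) \<le> 2 * \<rho> * (measure lebesgue (nbhd \<rho> (E i)) / measure lebesgue (ball (0::'a) \<rho>) + 1)"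
        using admissibleD(2)[OF m E(1)] \<rho> z a Ebd by (intro convex_diameter_bound) auto
      also have "\<dots> \<le> M"
        unfolding M_def using \<rho> Ebd(2)[of i] by (intro mult_left_mono add_right_mono divide_right_mono) auto
      finally show ?thesis by (simp add: dist_norm)
    qed
    then have "F i \<subseteq> cball 0 M" by (auto simp: F_def)
    then show ?thesis by (intro closure_minimal) auto
  qed
  have Fne: "closure (F i) \<noteq> {}" for i using Fop(3) by simp
  obtain L \<phi> where \<phi>: "strict_mono (\<phi> :: nat \<Rightarrow> nat)" and L: "compact L" "L \<noteq> {}" "L \<subseteq> cball 0 M"
    and h0: "hconv ((\<lambda>i. closure (F i)) \<circ> \<phi>) L"
    using blaschke_selection[of "\<lambda>i. closure (F i)" M, OF Fne Fsub] by blast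
  define G where "G i = F (\<phi> i)" for i
  have h: "hconv (\<lambda>i. closure (G i)) L" using h0 by (simp add: G_def comp_def)
  note Gop = Fop[of "\<phi> i" for i, folded G_def]
  have clL: "closed L" using L(1) compact_imp_closed by blast
  have cvL: "convex L" by (rule hconv_convex[OF h _ clL L(2)]) (simp add: convex_closure Gop)
  have cG: "closure (G i) \<in> lmeasurable" for i
    using Fsub[of "\<phi> i"] by (intro lmeasurable_compact) (auto simp: G_def compact_eq_bounded_closed intro: bounded_subset)
  have "m \<le> measure lebesgue (L \<inter> UNIV)"
  proof (rule measure_usc_hconv[OF h L(1) closed_UNIV])
    have "m \<le> measure lebesgue (closure (G i) \<inter> UNIV)" for i
      unfolding Gop(5)[of i, symmetric] using cG[of i] Gop(1) closure_subset by (intro measure_mono_fmeasurable) auto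
    then show "\<forall>\<^sub>F i in sequentially. m \<le> measure lebesgue (closure (G i) \<inter> UNIV)" by simp
  qed simp
  then have mL: "m \<le> measure lebesgue L" by simp
  let ?E = "interior L"
  have ne: "?E \<noteq> {}"
  proof
    assume "?E = {}"
    then have "negligible L" using cvL negligible_convex_interior by blast
    then show False using mL m by (simp add: negligible_imp_measure0)
  qed
  have inE: "\<forall>\<^sub>F i in sequentially. x \<in> G i" if "x \<in> ?E" for x
  proof -
    have "interior (closure (G i)) = G i" for i using Gop(1,2)[of i] by (simp add: convex_interior_closure interior_open)
    then show ?thesis using hconv_interior[OF h closed_closure _ that] Gop(2) by (simp add: convex_closure)
  qed
  have outE: "\<forall>\<^sub>F i in sequentially. z \<notin> G i" if "z \<notin> L" for z
    using hconv_exterior[OF h clL that] closure_subset by (auto elim!: eventually_mono)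
  have "emeasure lborel ?E \<le> liminf (\<lambda>i. emeasure lborel (G i))"
    using inE Gop(1) by (intro emeasure_fatou) auto
  also have "\<dots> = ennreal m" using Gop(6) Gop(1) by (simp add: Liminf_const)
  finally have "emeasure lebesgue ?E \<le> ennreal m" by simp
  moreover have "ennreal m \<le> emeasure lebesgue ?E"
  proof -
    have "L \<in> lmeasurable" using L(1) by (rule lmeasurable_compact)
    moreover have "negligible (sym_diff L ?E)"
      using negligible_convex_frontier[OF cvL] interior_subset[of L] closure_subset[of L]
      by (rule_tac negligible_subset) (auto simp: frontier_def)
    ultimately have "measure lebesgue ?E = measure lebesgue L" by (rule measure_negligible_symdiff)
    moreover have "?E \<in> lmeasurable" using compact_imp_bounded[OF L(1)] interior_subset by (intro lmeasurable_open) (auto intro: bounded_subset)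
    ultimately show ?thesis using mL by (simp add: emeasure_eq_measure2 ennreal_leI del: emeasure_completion)
  qed
  ultimately have adm: "?E \<in> admissible m"
    unfolding admissible_iff[OF m] using cvL by (auto simp: convex_interior)
  have "emeasure lborel (nbhd \<rho> (frontier ?E)) \<le> liminf (\<lambda>i. emeasure lborel (nbhd \<rho> (frontier (G i))))"
  proof (rule emeasure_fatou)
    fix y assume "y \<in> nbhd \<rho> (frontier ?E)"
    then obtain x z where x: "x \<in> ?E" "dist x y < \<rho>" and z: "z \<notin> ?E" "dist z y < \<rho>"
      unfolding nbhd_frontier by (auto simp: mem_nbhd)
    have "z \<in> closure (- L)" using z(1) by (simp add: closure_complement)
    then obtain z' where z': "z' \<notin> L" "dist z' z < \<rho> - dist z y"
      using z(2) by (metis ComplD closure_approachable diff_gt_0_iff_gt)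
    then have "dist z' y < \<rho>" using dist_triangle[of z' y z] by linarith
    then show "\<forall>\<^sub>F i in sequentially. y \<in> nbhd \<rho> (frontier (G i))"
      using eventually_conj[OF inE[OF x(1)] outE[OF z'(1)]] x(2)
      by (auto elim!: eventually_mono simp: nbhd_frontier mem_nbhd)
  qed auto
  then have le: "emeasure lebesgue (nbhd \<rho> (frontier ?E)) \<le> liminf (\<lambda>i. emeasure lebesgue (nbhd \<rho> (frontier (G i))))"
    by simp
  have P: "ennreal (1 / (2 * \<rho>)) * emeasure lebesgue (nbhd \<rho> (frontier ?E))
      \<le> liminf (\<lambda>i. ennreal (1 / (2 * \<rho>)) * emeasure lebesgue (nbhd \<rho> (frontier (G i))))"
    by (rule order_trans[OF mult_left_mono[OF le] ennreal_mult_liminf_le]) simp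
  have Q: "riesz_energy \<alpha> ?E \<le> liminf (\<lambda>i. riesz_energy \<alpha> (G i))"
    using inE Gop(1) by (intro riesz_energy_fatou) auto
  have "?en ?E \<le> liminf (\<lambda>i. ennreal (1 / (2 * \<rho>)) * emeasure lebesgue (nbhd \<rho> (frontier (G i)))) + liminf (\<lambda>i. riesz_energy \<alpha> (G i))"
    unfolding energy_eq[OF m adm \<rho>_def] by (rule add_mono[OF P Q])
  also have "\<dots> \<le> liminf (\<lambda>i. ?en (G i))"
    using energy_eq[OF m Fadm[of "\<phi> i" for i] \<rho>_def, of \<alpha>] ennreal_liminf_add_le by (simp add: G_def del: emeasure_completion)
  also have "\<dots> \<le> I"
  proof (rule ennreal_le_epsilon)
    fix d :: real assume d: "0 < d"
    obtain N where N: "1 / real (Suc N) < d" using nat_approx_posE[OF d] by auto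
    have "\<forall>\<^sub>F i in sequentially. ?en (G i) \<le> I + ennreal d"
    proof (rule eventually_sequentiallyI)
      fix i assume "N \<le> i"
      then have "N \<le> \<phi> i" using strict_mono_imp_increasing[OF \<phi>, of i] by simp
      then have "1 / real (Suc (\<phi> i)) \<le> 1 / real (Suc N)" by (simp add: frac_le)
      then have "ennreal (1 / real (Suc (\<phi> i))) \<le> ennreal d" using N by (intro ennreal_leI) linarith
      then show "?en (G i) \<le> I + ennreal d" 
        using less_imp_le[OF Fen[of "\<phi> i"]] unfolding G_def by (meson add_left_mono order_trans)
    qed
    then have "limsup (\<lambda>i. ?en (G i)) \<le> I + ennreal d" by (rule Limsup_bounded)
    then show "liminf (\<lambda>i. ?en (G i)) \<le> I + ennreal d"
      using Liminf_le_Limsup[of sequentially "\<lambda>i. ?en (G i)"] by (simp add: order_trans)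
  qed
  finally have "?en ?E \<le> I" .
  then have "\<forall>F\<in>admissible m. ?en ?E \<le> ?en F" unfolding I_def by (metis INF_lower order_trans)
  then show ?thesis using adm by (auto simp: is_minimizer_def)
qed

section \<open>Convergence of rescaled minimizers\<close>

lemma nbhd_scaleR:
  fixes A :: "'a::real_normed_vector set"
  assumes "0 < c"
  shows "nbhd (c * e) ((\<lambda>x. c *\<^sub>R x) ` A) = (\<lambda>x. c *\<^sub>R x) ` nbhd e A"
proof -
  have d: "dist (c *\<^sub>R x) (c *\<^sub>R y) < c * e \<longleftrightarrow> dist x y < e" for x y :: 'a
  proof -
    have "dist (c *\<^sub>R x) (c *\<^sub>R y) = c * dist x y"
      using assms by (simp add: dist_norm scaleR_diff_right[symmetric] del: scaleR_diff_right)
    then show ?thesis using assms by simp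
  qed
  show ?thesis
  proof (intro set_eqI iffI)
    fix z assume "z \<in> nbhd (c * e) ((\<lambda>x. c *\<^sub>R x) ` A)"
    then obtain x where x: "x \<in> A" "dist (c *\<^sub>R x) z < c * e" by (auto simp: mem_nbhd)
    have z: "z = c *\<^sub>R ((1/c) *\<^sub>R z)" using assms by simp
    have "dist x ((1/c) *\<^sub>R z) < e" using x(2) d[of x "(1/c) *\<^sub>R z"] z by simp
    then have "(1/c) *\<^sub>R z \<in> nbhd e A" using x(1) by (auto simp: mem_nbhd)
    then show "z \<in> (\<lambda>x. c *\<^sub>R x) ` nbhd e A" using z by blast
  next
    fix z assume "z \<in> (\<lambda>x. c *\<^sub>R x) ` nbhd e A"
    then show "z \<in> nbhd (c * e) ((\<lambda>x. c *\<^sub>R x) ` A)" using d by (auto simp: mem_nbhd)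
  qed
qed

lemma measure_scaleR:
  fixes S :: "'a::euclidean_space set"
  shows "measure lebesgue ((\<lambda>x. c *\<^sub>R x) ` S) = \<bar>c\<bar> ^ DIM('a) * measure lebesgue S"
  using measure_lebesgue_affine[of c 0 S] by simp

lemma hausdorff_dist_le:
  assumes e: "0 \<le> e" and A: "A \<subseteq> nbhd e B" and B: "B \<subseteq> nbhd e A"
  shows "hausdorff_dist A B \<le> ennreal e"
  unfolding hausdorff_dist_def
proof (intro max.boundedI SUP_least)
  fix x assume "x \<in> A"
  then obtain y where "y \<in> B" "dist y x < e" using A by (auto simp: mem_nbhd subset_iff)
  then show "(INF y\<in>B. ennreal (dist x y)) \<le> ennreal e"
    by (intro INF_lower2[of y]) (auto intro!: ennreal_leI simp: dist_commute)
next
  fix y assume "y \<in> B"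
  then obtain x where "x \<in> A" "dist x y < e" using B by (auto simp: mem_nbhd subset_iff)
  then show "(INF x\<in>A. ennreal (dist x y)) \<le> ennreal e"
    by (intro INF_lower2[of x]) (auto intro!: ennreal_leI)
qed

lemma hausdorff_dist_less_imp_subset:
  assumes "hausdorff_dist A B < ennreal e"
  shows "A \<subseteq> nbhd e B"
proof
  fix x assume "x \<in> A"
  then have "(INF y\<in>B. ennreal (dist x y)) \<le> hausdorff_dist A B"
    unfolding hausdorff_dist_def by (intro max.coboundedI1 SUP_upper2[of x]) auto
  then have "(INF y\<in>B. ennreal (dist x y)) < ennreal e" using assms by (rule le_less_trans)
  then obtain y where "y \<in> B" "ennreal (dist x y) < ennreal e" by (auto simp: INF_less_iff)
  then show "x \<in> nbhd e B" by (auto simp: mem_nbhd dist_commute ennreal_less_iff)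
qed

lemma ennreal_tendsto_0I:
  fixes f :: "'b \<Rightarrow> ennreal"
  assumes "\<And>e. 0 < e \<Longrightarrow> \<forall>\<^sub>F x in F. f x \<le> ennreal e"
  shows "(f \<longlongrightarrow> 0) F"
proof (rule order_tendstoI)
  fix a :: ennreal assume "0 < a"
  then obtain b where b: "0 < b" "b < a" using dense by blast
  then obtain e where e: "0 \<le> e" "b = ennreal e" by (metis less_top_ennreal less_trans top.extremum_strict less_top top.not_eq_extremum)
  then have "0 < e" using b by simp
  show "\<forall>\<^sub>F x in F. f x < a"
    using assms[OF \<open>0 < e\<close>] b(2) e(2) by (auto elim!: eventually_mono intro: le_less_trans)
qed simp

text \<open>Sets of equal volume lose as much as they gain, and the gain is contained in a thin shell.\<close>

lemma symdiff_ball_le: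
  fixes A :: "'a::euclidean_space set"
  assumes A: "A \<in> lmeasurable" "measure lebesgue A = measure lebesgue (ball (0::'a) s)" and s: "0 < s" and e: "0 < e"
    and sub: "A \<subseteq> nbhd e (ball 0 s)"
  shows "emeasure lebesgue (sym_diff A (ball 0 s)) \<le> ennreal (2 * (measure lebesgue (ball (0::'a) (s + e)) - measure lebesgue (ball (0::'a) s)))"
proof -
  let ?\<mu> = "measure lebesgue :: 'a set \<Rightarrow> real" let ?B = "ball (0::'a) s"
  have sub': "A \<subseteq> ball 0 (s + e)" using sub nbhd_ball[OF s e, of "0::'a"] by simp
  have i: "A \<inter> ?B \<in> sets lebesgue" using A by (auto dest: fmeasurableD)
  have d1: "?\<mu> (A - ?B) = ?\<mu> A - ?\<mu> (A \<inter> ?B)" 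
    using measurable_measure_Diff[OF A(1) i] by (simp add: Diff_Int)
  have d2: "?\<mu> (?B - A) = ?\<mu> ?B - ?\<mu> (A \<inter> ?B)" 
    using measurable_measure_Diff[OF lmeasurable_ball[of "0::'a" s] i] by (simp add: Diff_Int)
  have m1: "A - ?B \<in> lmeasurable" "?B - A \<in> lmeasurable" using A by (auto intro!: fmeasurable.Diff dest: fmeasurableD)
  have "?\<mu> (A - ?B) \<le> ?\<mu> (ball 0 (s + e) - ?B)"
    using sub' m1 by (intro measure_mono_fmeasurable fmeasurable.Diff) (auto dest: fmeasurableD)
  also have "\<dots> = ?\<mu> (ball 0 (s + e)) - ?\<mu> ?B"
    using e by (intro measurable_measure_Diff) auto
  finally have le: "?\<mu> (A - ?B) \<le> ?\<mu> (ball 0 (s + e)) - ?\<mu> ?B" .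
  have "?\<mu> (sym_diff A ?B) \<le> ?\<mu> (A - ?B) + ?\<mu> (?B - A)"
    using m1 by (intro measure_Un_le) (auto dest: fmeasurableD)
  also have "\<dots> = 2 * ?\<mu> (A - ?B)" using d1 d2 A(2) by simp
  also have "\<dots> \<le> 2 * (?\<mu> (ball 0 (s + e)) - ?\<mu> ?B)" using le by simp
  finally have "?\<mu> (sym_diff A ?B) \<le> 2 * (?\<mu> (ball 0 (s + e)) - ?\<mu> ?B)" .
  moreover have "sym_diff A ?B \<in> lmeasurable" using m1 by (rule fmeasurable.Un)
  ultimately show ?thesis by (simp add: emeasure_eq_measure2 ennreal_leI del: emeasure_completion)
qed

text \<open>Comparison with the ball of volume \<open>m\<close>. Its Riesz energy is at most \<open>m * C\<close>, since the
potential of a ball of radius at most \<open>2 * s\<close> is at most \<open>C\<close>. Multiplication by \<open>2 * \<rho>\<close>, with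
\<open>\<rho> = r * m powr (1 / n)\<close> and \<open>n\<close> the dimension, and division by \<open>m\<close> on rescaling to unit volume
leave a term that vanishes with \<open>m\<close>.\<close>

lemma minimizer_dilation_bound:
  fixes E :: "'a::euclidean_space set"
  assumes m: "0 < m" "m \<le> 1" and r: "0 < r" and s: "0 < s" "measure lebesgue (ball (0::'a) s) = 1"
    and C: "0 \<le> C" "riesz_potential TYPE('a) \<alpha> (2 * s) = ennreal C"
    and E: "is_minimizer \<alpha> r m E"
  shows "convex (rescaled m E)" "rescaled m E \<noteq> {}" "rescaled m E \<in> lmeasurable"
    "nbhd r (rescaled m E) \<in> lmeasurable" "measure lebesgue (rescaled m E) = 1"
    "measure lebesgue (nbhd r (rescaled m E)) \<le> measure lebesgue (ball (0::'a) (s + r)) + 2 * r * C * m powr (1 / real DIM('a))"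
proof -
  let ?n = "DIM('a)"
  let ?\<mu> = "measure lebesgue :: 'a set \<Rightarrow> real"
  define \<mu> where "\<mu> = m powr (1 / real ?n)"
  define \<rho> where "\<rho> = r * m powr (1 / real ?n)"
  have \<mu>: "0 < \<mu>" "\<mu> \<le> 1" "\<mu> ^ ?n = m"
    using m by (auto simp: \<mu>_def powr_powr powr_realpow[symmetric] powr_le1)
  have \<rho>: "0 < \<rho>" "\<rho> = r * \<mu>" using r \<mu> by (auto simp: \<rho>_def \<mu>_def)
  have inv: "m powr (- 1 / real ?n) = 1 / \<mu>" by (simp add: \<mu>_def powr_minus_divide)
  have resc: "rescaled m E = (\<lambda>x. (1 / \<mu>) *\<^sub>R x) ` E" unfolding rescaled_def inv by (rule refl)
  have ball_m: "?\<mu> (ball 0 (t * \<mu>)) = m * ?\<mu> (ball 0 t)" if "0 \<le> t" for t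
    using that \<mu> by (simp add: measure_ball_eq power_mult_distrib del: measure_completion)
  have EA: "E \<in> admissible m" using E by (simp add: is_minimizer_def)
  note Ep = admissibleD[OF m(1) EA]
  define R where "R = s * \<mu>"
  have R: "0 < R" "?\<mu> (ball 0 R) = m" using s \<mu> ball_m[of s] by (auto simp: R_def)
  have BA: "ball (0::'a) R \<in> admissible m"
    using R(2) emeasure_eq_measure2[OF lmeasurable_ball, of "0::'a" R] unfolding admissible_iff[OF m(1)] by auto
  have CR: "riesz_potential TYPE('a) \<alpha> (2 * R) \<le> ennreal C"
    unfolding C(2)[symmetric] using s \<mu> by (intro riesz_potential_mono) (simp add: R_def mult_left_le)
  let ?b = "?\<mu> (nbhd \<rho> (frontier (ball 0 R)))"
  have "energy \<alpha> r m E \<le> energy \<alpha> r m (ball (0::'a) R)" using E BA by (simp add: is_minimizer_def)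
  also have "\<dots> \<le> ennreal (?b / (2 * \<rho>) + m * C)" by (rule energy_ball_le[OF m(1) r BA \<rho>_def C(1) CR])
  finally have le: "emeasure lebesgue (nbhd \<rho> (frontier E)) \<le> ennreal (2 * \<rho> * (?b / (2 * \<rho>) + m * C))"
    using \<rho> m C by (intro nbhd_frontier_le_energy[OF m(1) r EA \<rho>_def]) auto
  then have fin: "emeasure lebesgue (nbhd \<rho> (frontier E)) < \<infinity>" by (rule le_less_trans) simp
  have nn: "0 \<le> 2 * \<rho> * (?b / (2 * \<rho>) + m * C)" using \<rho> m C by simp
  have "?\<mu> (nbhd \<rho> (frontier E)) \<le> 2 * \<rho> * (?b / (2 * \<rho>) + m * C)"
    using enn2real_mono[OF le] nn unfolding measure_def by (simp del: emeasure_completion)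
  also have "\<dots> = ?b + 2 * \<rho> * m * C" using \<rho>(1) by (simp add: field_simps)
  finally have fr: "?\<mu> (nbhd \<rho> (frontier E)) \<le> ?b + 2 * \<rho> * m * C" .
  note bd = convex_finite_Per_bounded[OF Ep(2,4) \<rho>(1) fin]
  have "?\<mu> (nbhd \<rho> E) \<le> ?\<mu> (ball 0 (R + \<rho>)) + (?\<mu> (nbhd \<rho> (frontier E)) - ?b)"
    using Ep R(2) by (intro measure_nbhd_le_ball_add_boundary_excess[OF \<rho>(1) R(1) bd(2)]) auto
  also have "\<dots> \<le> m * ?\<mu> (ball 0 (s + r)) + 2 * \<rho> * m * C"
    using fr ball_m[of "s + r"] s r \<rho>(2) by (simp add: R_def distrib_right)
  finally have main: "?\<mu> (nbhd \<rho> E) \<le> m * ?\<mu> (ball 0 (s + r)) + 2 * \<rho> * m * C" .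
  have nb: "nbhd r (rescaled m E) = (\<lambda>x. (1 / \<mu>) *\<^sub>R x) ` nbhd \<rho> E"
    using nbhd_scaleR[of "1 / \<mu>" \<rho> E] \<mu> by (simp add: resc \<rho>(2))
  have op: "open (rescaled m E)" using open_scaling[of "1 / \<mu>" E] Ep(1) \<mu> by (simp add: resc)
  have bn: "bounded (rescaled m E)" unfolding resc by (rule bounded_scaling[OF bd(2)])
  show "convex (rescaled m E)" unfolding resc by (rule convex_scaling[OF Ep(2)])
  show "rescaled m E \<noteq> {}" using Ep(3) by (simp add: resc)
  show "rescaled m E \<in> lmeasurable" using op bn by (rule lmeasurable_open[rotated])
  show "nbhd r (rescaled m E) \<in> lmeasurable" using bn by simp
  have pw: "\<bar>1 / \<mu>\<bar> ^ ?n = 1 / m" using \<mu> by (simp add: power_divide)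
  show "measure lebesgue (rescaled m E) = 1" unfolding resc measure_scaleR pw using Ep(5) m by simp
  have "?\<mu> (nbhd r (rescaled m E)) = ?\<mu> (nbhd \<rho> E) / m" unfolding nb measure_scaleR pw by simp
  also have "\<dots> \<le> (m * ?\<mu> (ball 0 (s + r)) + 2 * \<rho> * m * C) / m" using main m by (intro divide_right_mono) auto
  also have "\<dots> = ?\<mu> (ball 0 (s + r)) + 2 * r * C * \<mu>" using m by (simp add: \<rho>(2) field_simps)
  finally show "?\<mu> (nbhd r (rescaled m E)) \<le> ?\<mu> (ball 0 (s + r)) + 2 * r * C * m powr (1 / real ?n)"
    by (simp add: \<mu>_def)
qed

theorem rescaled_minimizers_converge:
  fixes E :: "real \<Rightarrow> 'a::euclidean_space set"
  assumes \<alpha>: "0 < \<alpha>" "\<alpha> < real DIM('a)" and r: "0 < r"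
    and E: "\<And>m. 0 < m \<Longrightarrow> is_minimizer \<alpha> r m (E m)" and s1: "emeasure lebesgue (ball (0::'a) s) = 1"
  shows "\<exists>t :: real \<Rightarrow> 'a.
      ((\<lambda>m. emeasure lebesgue (sym_diff ((+) (t m) ` rescaled m (E m)) (ball 0 s))) \<longlongrightarrow> 0) (at_right 0) \<and>
      ((\<lambda>m. hausdorff_dist ((+) (t m) ` rescaled m (E m)) (ball 0 s)) \<longlongrightarrow> 0) (at_right 0)"
proof -
  let ?\<mu> = "measure lebesgue :: 'a set \<Rightarrow> real"
  have s: "0 < s"
  proof (rule ccontr)
    assume "\<not> 0 < s"
    then have "ball (0::'a) s = {}" by simp
    then show False using s1 by (simp only: emeasure_empty) simp
  qed
  have ms: "?\<mu> (ball 0 s) = 1" using s1 by (simp add: measure_def del: emeasure_completion)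
  obtain C where C: "0 \<le> C" "riesz_potential TYPE('a) \<alpha> (2 * s) = ennreal C"
    using riesz_potential_finite[OF \<alpha>, of "2 * s"] s by (auto simp: less_top_ennreal)
  define F where "F m = rescaled m (E m)" for m
  let ?h = "\<lambda>m t. hausdorff_dist ((+) t ` F m) (ball 0 s)"
  note bound = minimizer_dilation_bound[OF _ _ r s ms C E, folded F_def]
  have close: "\<forall>\<^sub>F m in at_right 0. \<exists>t. ?h m t \<le> ennreal e" if e: "0 < e" for e
  proof -
    obtain d where d: "0 < d" and stab: "\<And>A::'a set. convex A \<Longrightarrow> A \<noteq> {} \<Longrightarrow> A \<in> lmeasurable \<Longrightarrow> nbhd r A \<in> lmeasurable \<Longrightarrow>
        ?\<mu> (ball 0 s) \<le> ?\<mu> A \<Longrightarrow> ?\<mu> (nbhd r A) \<le> ?\<mu> (ball 0 (s + r)) + d \<Longrightarrow>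
        (\<exists>t. (+) t ` A \<subseteq> nbhd e (ball 0 s) \<and> ball 0 s \<subseteq> nbhd e ((+) t ` A))"
      using ball_stability[OF s r e, where 'a='a] by blast
    have "((\<lambda>m. 2 * r * C * m powr (1 / real DIM('a))) \<longlongrightarrow> 2 * r * C * 0 powr (1 / real DIM('a))) (at_right 0)"
      by (intro tendsto_intros tendsto_powr') (auto simp: eventually_at_right_less intro: eventually_mono[OF eventually_at_right_less])
    then have "\<forall>\<^sub>F m in at_right 0. 2 * r * C * m powr (1 / real DIM('a)) < d"
      using d by (intro order_tendstoD(2)) auto
    then show ?thesis using eventually_at_right_real[of 0 1, simplified]
    proof eventually_elim
      case (elim m)
      then have m: "0 < m" "m \<le> 1" by auto
      have "\<exists>t. (+) t ` F m \<subseteq> nbhd e (ball 0 s) \<and> ball 0 s \<subseteq> nbhd e ((+) t ` F m)"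
        using bound[OF m m(1)] elim(1) ms by (intro stab) auto
      then show ?case using hausdorff_dist_le[of e] e by (meson less_imp_le)
    qed
  qed
  \<comment> \<open>The translations must not depend on the accuracy \<open>e\<close>; so for each \<open>m\<close> one is chosen that
    minimizes the Hausdorff distance up to \<open>m\<close>, which suffices as \<open>m\<close> tends to \<open>0\<close>.\<close>
  have "\<exists>t. 0 < m \<longrightarrow> ?h m t \<le> (INF t. ?h m t) + ennreal m" for m
  proof (cases "0 < m \<and> (INF t. ?h m t) \<noteq> \<infinity>")
    case True
    then show ?thesis using INF_approx_ennreal[of m "INF t. ?h m t" "?h m" UNIV] by (auto intro: less_imp_le)
  next
    case False
    then show ?thesis by auto
  qed
  then obtain t where t: "\<And>m. 0 < m \<Longrightarrow> ?h m (t m) \<le> (INF t. ?h m t) + ennreal m" by metis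
  have H: "\<forall>\<^sub>F m in at_right 0. ?h m (t m) \<le> ennreal e" if e: "0 < e" for e
  proof -
    have "0 < e / 2" using e by simp
    from close[OF this] eventually_at_right_real[OF this] show ?thesis
    proof eventually_elim
      case (elim m)
      then have m: "0 < m" "m < e / 2" by auto
      have "(INF t. ?h m t) \<le> ennreal (e / 2)" using elim(1) by (meson INF_lower2 UNIV_I)
      then have "?h m (t m) \<le> ennreal (e / 2) + ennreal (e / 2)"
        using t[OF m(1)] m by (meson add_mono ennreal_leI less_imp_le order_trans)
      also have "\<dots> = ennreal e" using e by (simp add: ennreal_plus[symmetric] del: ennreal_plus)
      finally show ?case .
    qed
  qed
  have "((\<lambda>m. ?h m (t m)) \<longlongrightarrow> 0) (at_right 0)" using H by (rule ennreal_tendsto_0I)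
  moreover have "((\<lambda>m. emeasure lebesgue (sym_diff ((+) (t m) ` F m) (ball 0 s))) \<longlongrightarrow> 0) (at_right 0)"
  proof (rule ennreal_tendsto_0I)
    fix \<epsilon> :: real assume \<epsilon>: "0 < \<epsilon>"
    let ?g = "\<lambda>e. 2 * (unit_ball_vol (real DIM('a)) * (s + e) ^ DIM('a) - ?\<mu> (ball 0 s))"
    have "(?g \<longlongrightarrow> ?g 0) (at_right 0)" by (intro tendsto_intros)
    moreover have "?g 0 = 0" using s by (simp add: measure_ball_eq del: measure_completion)
    ultimately have "\<forall>\<^sub>F e in at_right 0. ?g e < \<epsilon>" using \<epsilon> by (intro order_tendstoD(2)) auto
    then have "\<forall>\<^sub>F e in at_right 0. ?g e < \<epsilon> \<and> 0 < e" using eventually_at_right_less by (rule eventually_conj)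
    then obtain e where e: "?g e < \<epsilon>" "0 < e" using eventually_happens'[OF trivial_limit_at_right_real] by blast
    have ge: "2 * (?\<mu> (ball 0 (s + e)) - ?\<mu> (ball 0 s)) \<le> \<epsilon>"
      using e s by (simp add: measure_ball_eq del: measure_completion)
    have "0 < e / 2" using e by simp
    from H[OF this] eventually_at_right_real[OF zero_less_one]
    show "\<forall>\<^sub>F m in at_right 0. emeasure lebesgue (sym_diff ((+) (t m) ` F m) (ball 0 s)) \<le> ennreal \<epsilon>"
    proof eventually_elim
      case (elim m)
      then have m: "0 < m" "m \<le> 1" by auto
      have "?h m (t m) < ennreal e" using elim(1) e(2) by (elim le_less_trans) (simp add: ennreal_less_iff)
      then have sub: "(+) (t m) ` F m \<subseteq> nbhd e (ball 0 s)" by (rule hausdorff_dist_less_imp_subset)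
      have "(+) (t m) ` F m \<in> lmeasurable" using bound(3)[OF m m(1)] by (rule measurable_translation)
      moreover have "?\<mu> ((+) (t m) ` F m) = ?\<mu> (ball 0 s)" unfolding measure_translation bound(5)[OF m m(1)] ms by simp
      ultimately have "emeasure lebesgue (sym_diff ((+) (t m) ` F m) (ball 0 s)) \<le> ennreal (2 * (?\<mu> (ball 0 (s + e)) - ?\<mu> (ball 0 s)))"
        by (rule symdiff_ball_le[OF _ _ s e(2) sub])
      also have "\<dots> \<le> ennreal \<epsilon>" using ge by (rule ennreal_leI)
      finally show ?case .
    qed
  qed
  ultimately show ?thesis unfolding F_def by blast
qed

theorem theorem4p1:
  fixes \<alpha> r :: real
  assumes "0 < \<alpha>" and "\<alpha> < real CARD('n::finite)" and "0 < r"
  shows "(\<forall>m>0. \<exists>E :: (real ^ 'n) set. is_minimizer \<alpha> r m E) \<and>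
    (\<forall>(E :: real \<Rightarrow> (real ^ 'n) set) (s :: real).
       (\<forall>m>0. is_minimizer \<alpha> r m (E m)) \<longrightarrow> emeasure lebesgue (ball (0 :: real ^ 'n) s) = 1 \<longrightarrow>
       (\<exists>t :: real \<Rightarrow> real ^ 'n.
          ((\<lambda>m. emeasure lebesgue (sym_diff ((+) (t m) ` rescaled m (E m)) (ball 0 s)))
             \<longlongrightarrow> 0) (at_right 0) \<and>
          ((\<lambda>m. hausdorff_dist ((+) (t m) ` rescaled m (E m)) (ball 0 s)) \<longlongrightarrow> 0) (at_right 0)))"
proof -
  have "\<alpha> < real DIM(real ^ 'n)" using assms(2) by simp
  then show ?thesis
    using exists_minimizer[OF assms(1) _ assms(3)] rescaled_minimizers_converge[OF assms(1) _ assms(3)] by blast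
qed

end
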